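(* $[2,2,0,2]=4$. That is: let $n\ge 4$, let $\mathcal{F}=\{r_1,r_2\}$ be a fault with two distinct red vertices and let $g_1,g_2,g_3,g_4$ be four distinct green vertices in $\mathcal{Q}_n$. Then there exists a $2$-path covering of $\mathcal{Q}_n-\mathcal{F}$ with one path connecting $g_1$ to $g_2$ and the other connecting $g_3$ to $g_4$. The claim is not true for $n=3$ (there are such vertices in $\mathcal{Q}_3$ for which no such covering exists).
   Context: $\mathcal{Q}_n$ is the $n$-dimensional binary hypercube: its vertices are all binary sequences of length $n$, adjacent iff they differ in exactly one position. A vertex is even or odd according to the parity of its number of 1's; vertices of one parity are called red and those of the other parity green. A path covering of a graph is a set of vertex-disjoint paths that cover all vertices of the graph; a $k$-path covering is a path covering by exactly $k$ paths. A fault $\mathcal{F}$ in $\mathcal{Q}_n$ is a set of deleted vertices; its mass is $|\mathcal{F}|$ and its charge is $|r(\mathcal{F})-g(\mathcal{F})|$, where $r(\mathcal{F})$, $g(\mathcal{F})$ are the numbers of red and green vertices in $\mathcal{F}$. $\mathcal{Q}_n-\mathcal{F}$ is the subgraph induced by the non-deleted vertices. A pair of vertices (or a path, via its two endpoints) is neutral if the two vertices have opposite parity and charged if they have the same parity; a charged pair is red (green) if its elements are red (green). A set $\mathcal{E}$ of disjoint pairs of vertices is in balance with $\mathcal{F}$ if all vertices in the pairs lie in $\mathcal{Q}_n-\mathcal{F}$ and $r(\mathcal{F})-g(\mathcal{F})=g(\mathcal{E})-r(\mathcal{E})$, where $r(\mathcal{E})$, $g(\mathcal{E})$ are the numbers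 of red and green pairs in $\mathcal{E}$. For a fault $\mathcal{F}$ of mass $M$ and charge $C$ in $\mathcal{Q}_n$, one can freely prescribe ends for a path covering of $\mathcal{Q}_n-\mathcal{F}$ with $N$ neutral paths and $O$ charged paths if (i) there is at least one set $\mathcal{E}$ of disjoint pairs of vertices in balance with $\mathcal{F}$ containing exactly $N$ neutral and $O$ charged pairs, and (ii) for every such $\mathcal{E}$ there is a path covering of $\mathcal{Q}_n-\mathcal{F}$ whose set of pairs of end vertices is $\mathcal{E}$. For nonnegative integers $M,C,N,O$, $\mathcal{A}_{M,C,N,O}$ is the set of nonnegative integers $m$ such that $m\ge\log_2[M+C+2N+2O]$ and for every $n\ge m$ and every fault $\mathcal{F}$ of mass $M$ and charge $C$ in $\mathcal{Q}_n$ one can freely prescribe ends for a path covering of $\mathcal{Q}_n-\mathcal{F}$ with $N$ neutral and $O$ charged paths. $[M,C,N,O]$ is the smallest element of $\mathcal{A}_{M,C,N,O}$ if this set is nonempty. *)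

theory Defs
  imports Complex_Main "Graph_Theory.Graph_Theory"
begin

(* Undirected graphs are rendered as symmetric digraphs in the sense of Graph_Theory. *)
definition hypercube :: "nat \<Rightarrow> (bool list, bool list \<times> bool list) pre_digraph" where
  "hypercube n =
     \<lparr> verts = {v. length v = n},
       arcs = {(u, v). length u = n \<and> length v = n \<and> card {i. i < n \<and> u ! i \<noteq> v ! i} = 1},
       tail = fst, head = snd \<rparr>"

definition even_vertex :: "bool list \<Rightarrow> bool" where
  "even_vertex v \<longleftrightarrow> even (count_list v True)"

(* Which parity class is called red is a convention left open: the parameter c says
   whether red means even (c = True) or odd (c = False). *)
definition red :: "bool \<Rightarrow> bool list \<Rightarrow> bool" where
  "red c v \<longleftrightarrow> (even_vertex v \<longleftrightarrow> c)"

definition green :: "bool \<Rightarrow> bool list \<Rightarrow> bool" where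
  "green c v \<longleftrightarrow> \<not> red c v"


(* A path is a nonempty list of distinct vertices; a list and its reversal represent the same
   path, and vertex-disjointness prevents a covering from containing both. *)
definition path_ends :: "'a list \<Rightarrow> 'a set" where
  "path_ends p = {hd p, last p}"

definition path_covering :: "('a, 'b) pre_digraph \<Rightarrow> 'a list set \<Rightarrow> bool" where
  "path_covering G P \<longleftrightarrow>
     (\<forall>p\<in>P. vpath p G) \<and> pairwise (\<lambda>p q. disjnt (set p) (set q)) P \<and> (\<Union>p\<in>P. set p) = verts G"

definition k_path_covering :: "nat \<Rightarrow> ('a, 'b) pre_digraph \<Rightarrow> 'a list set \<Rightarrow> bool" where
  "k_path_covering k G P \<longleftrightarrow> path_covering G P \<and> finite P \<and> card P = k"


definition fault :: "nat \<Rightarrow> bool list set \<Rightarrow> bool" where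
  "fault n F \<longleftrightarrow> F \<subseteq> verts (hypercube n)"

definition mass :: "bool list set \<Rightarrow> nat" where
  "mass F = card F"

definition signed_charge :: "bool \<Rightarrow> bool list set \<Rightarrow> int" where
  "signed_charge c F = int (card {v\<in>F. red c v}) - int (card {v\<in>F. green c v})"

definition charge :: "bool \<Rightarrow> bool list set \<Rightarrow> nat" where
  "charge c F = nat \<bar>signed_charge c F\<bar>"

definition faulty_hypercube ::
    "nat \<Rightarrow> bool list set \<Rightarrow> (bool list, bool list \<times> bool list) pre_digraph" where
  "faulty_hypercube n F = hypercube n \<restriction> (verts (hypercube n) - F)"


(* A pair of vertices is a two-element set. *)
definition neutral_pair :: "bool list set \<Rightarrow> bool" where
  "neutral_pair e \<longleftrightarrow> (\<exists>u v. e = {u, v} \<and> even_vertex u \<noteq> even_vertex v)"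

definition charged_pair :: "bool list set \<Rightarrow> bool" where
  "charged_pair e \<longleftrightarrow> (\<exists>u v. e = {u, v} \<and> u \<noteq> v \<and> even_vertex u = even_vertex v)"

definition red_pair :: "bool \<Rightarrow> bool list set \<Rightarrow> bool" where
  "red_pair c e \<longleftrightarrow> charged_pair e \<and> (\<forall>v\<in>e. red c v)"

definition green_pair :: "bool \<Rightarrow> bool list set \<Rightarrow> bool" where
  "green_pair c e \<longleftrightarrow> charged_pair e \<and> (\<forall>v\<in>e. green c v)"

definition disjoint_pairs :: "bool list set set \<Rightarrow> bool" where
  "disjoint_pairs E \<longleftrightarrow> (\<forall>e\<in>E. card e = 2) \<and> pairwise disjnt E"

definition in_balance :: "bool \<Rightarrow> nat \<Rightarrow> bool list set \<Rightarrow> bool list set set \<Rightarrow> bool" where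
  "in_balance c n F E \<longleftrightarrow>
     \<Union>E \<subseteq> verts (faulty_hypercube n F) \<and>
     signed_charge c F = int (card {e\<in>E. green_pair c e}) - int (card {e\<in>E. red_pair c e})"

definition prescribable_ends ::
    "bool \<Rightarrow> nat \<Rightarrow> bool list set \<Rightarrow> nat \<Rightarrow> nat \<Rightarrow> bool list set set \<Rightarrow> bool" where
  "prescribable_ends c n F N K E \<longleftrightarrow>
     disjoint_pairs E \<and> in_balance c n F E \<and>
     card {e\<in>E. neutral_pair e} = N \<and> card {e\<in>E. charged_pair e} = K"

definition freely_prescribe_ends :: "bool \<Rightarrow> nat \<Rightarrow> bool list set \<Rightarrow> nat \<Rightarrow> nat \<Rightarrow> bool" where
  "freely_prescribe_ends c n F N K \<longleftrightarrow>
     (\<exists>E. prescribable_ends c n F N K E) \<and>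
     (\<forall>E. prescribable_ends c n F N K E \<longrightarrow>
        (\<exists>P. path_covering (faulty_hypercube n F) P \<and> path_ends ` P = E))"

(* The set A_{M,C,N,O}; O is written K, since O is Isabelle's infix for relation composition. *)
definition admissible_dims :: "bool \<Rightarrow> nat \<Rightarrow> nat \<Rightarrow> nat \<Rightarrow> nat \<Rightarrow> nat set" where
  "admissible_dims c M C N K =
     {m. real m \<ge> log 2 (real (M + C + 2 * N + 2 * K)) \<and>
         (\<forall>n\<ge>m. \<forall>F. fault n F \<and> mass F = M \<and> charge c F = C \<longrightarrow>
            freely_prescribe_ends c n F N K)}"

(* The number [M,C,N,O]; unspecified if the set of admissible dimensions is empty. *)
definition least_dim :: "bool \<Rightarrow> nat \<Rightarrow> nat \<Rightarrow> nat \<Rightarrow> nat \<Rightarrow> nat" where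
  "least_dim c M C N K = (LEAST m. m \<in> admissible_dims c M C N K)"


definition two_path_covering_joining ::
    "nat \<Rightarrow> bool list set \<Rightarrow> bool list \<Rightarrow> bool list \<Rightarrow> bool list \<Rightarrow> bool list \<Rightarrow> bool" where
  "two_path_covering_joining n F a b c d \<longleftrightarrow>
     (\<exists>p q. k_path_covering 2 (faulty_hypercube n F) {p, q} \<and>
            path_ends p = {a, b} \<and> path_ends q = {c, d})"

definition two_red_four_green :: "bool \<Rightarrow> nat \<Rightarrow> bool list list \<Rightarrow> bool list list \<Rightarrow> bool" where
  "two_red_four_green c n rs gs \<longleftrightarrow>
     length rs = 2 \<and> length gs = 4 \<and> distinct rs \<and> distinct gs \<and>
     set rs \<union> set gs \<subseteq> verts (hypercube n) \<and>
     (\<forall>r\<in>set rs. red c r) \<and> (\<forall>g\<in>set gs. green c g)"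

end

theory Submission
  imports Defs
begin

text \<open>
  Split the \<open>n + 1\<close>-cube along a coordinate in which the two deleted red vertices
  differ, so that each half, an \<open>n\<close>-cube, loses exactly one of them.  What has to be
  known about a half \<open>Q\<close> with one red vertex \<open>r\<close> deleted is:

  \<^item> any two green vertices are joined by a path through all of \<open>Q - r\<close>
    (\<open>spans_cube_minus\<close>), and
  \<^item> for green \<open>a\<close>, \<open>b\<close>, \<open>c\<close> and red \<open>x\<close> there are two disjoint paths, from \<open>a\<close> to \<open>b\<close>
    and from \<open>c\<close> to \<open>x\<close>, that cover \<open>Q - r\<close> (\<open>links_cube_minus\<close>).

  Both follow from the statement for \<open>Q\<close> itself once \<open>n \<ge> 4\<close>: delete a second red vertex
  \<open>x\<close>, let paths end in green neighbours of \<open>x\<close>, and put \<open>x\<close> back as a link between them or as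
  a new end.  A red vertex has at least four neighbours, so enough of them are not
  prescribed ends already.  The four green ends are then distributed \<open>4 + 0\<close>, \<open>3 + 1\<close> or
  \<open>2 + 2\<close> over the halves, and in each case suitable paths of the halves are joined along edges
  between the halves.

  The induction starts at \<open>n = 4\<close>.  Up to symmetry the deleted vertices are \<open>0000\<close> and one
  of \<open>1100\<close>, \<open>1111\<close>; explicit coverings for 42 and 12 positions of the ends represent all
  positions under the symmetries that fix the deleted pair.

  For \<open>n = 3\<close> let \<open>r\<close>, \<open>s\<close> be the deleted vertices and ask for a path between their antipodes and
  one between the other two green vertices.  Each of these latter two has only one neighbour left,
  and the two neighbours are the only red vertices left, so nothing remains to leave an
  antipode (\<open>no_linkage_in_Q3\<close>).

  Everything is done for vertex sets rather than paths: \<open>spans A a b\<close> says that \<open>A\<close> is the vertex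
  set of a path from \<open>a\<close> to \<open>b\<close>.  Colours enter only through the relation of having the same
  parity, so that no convention about red and green is needed before the end.
\<close>

section \<open>Hamming distance in the cube\<close>

text \<open>
  Recursion along the lists lets simplification split off the first coordinate;
  \<open>hamming_conv_card\<close> gives the usual description.
\<close>

fun hamming :: "bool list \<Rightarrow> bool list \<Rightarrow> nat" where
  "hamming (x # xs) (y # ys) = (if x = y then 0 else 1) + hamming xs ys"
| "hamming _ _ = 0"

definition cube :: "nat \<Rightarrow> bool list set" where
  "cube n = {v. length v = n}"

lemma finite_cube: "finite (cube n)"
  using finite_lists_length_eq[of "UNIV :: bool set" n] by (simp add: cube_def)

text \<open>
  Deleting one vertex from each half of a cube leaves two translates of a cube with one
  deleted vertex; this is the form in which the induction meets the cube.
\<close>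

lemma cube_Suc_minus:
  assumes "t' \<noteq> t"
  shows "cube (Suc n) - {t # r, t' # s} = Cons t ` (cube n - {r}) \<union> Cons t' ` (cube n - {s})"
proof (rule set_eqI)
  fix v show "v \<in> cube (Suc n) - {t # r, t' # s} \<longleftrightarrow>
    v \<in> Cons t ` (cube n - {r}) \<union> Cons t' ` (cube n - {s})"
    using assms by (cases v) (auto simp: cube_def)
qed

lemma hamming_self [simp]: "hamming v v = 0"
  by (induction v) auto

lemma hamming_sym: "hamming u v = hamming v u"
  by (induction u v rule: hamming.induct) auto

lemma hamming_eq_0_iff: "length u = length v \<Longrightarrow> hamming u v = 0 \<longleftrightarrow> u = v"
  by (induction u v rule: list_induct2) auto

lemma hamming_conv_card:
  "length u = length v \<Longrightarrow> hamming u v = card {i. i < length v \<and> u ! i \<noteq> v ! i}"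
proof (induction u v rule: list_induct2)
  case (Cons x xs y ys)
  let ?D = "{i. i < length ys \<and> xs ! i \<noteq> ys ! i}"
  have "{i. i < length (y # ys) \<and> (x # xs) ! i \<noteq> (y # ys) ! i} =
        (if x = y then {} else {0}) \<union> Suc ` ?D"
  proof (rule set_eqI)
    fix i show "i \<in> {i. i < length (y # ys) \<and> (x # xs) ! i \<noteq> (y # ys) ! i} \<longleftrightarrow>
      i \<in> (if x = y then {} else {0}) \<union> Suc ` ?D"
      by (cases i) auto
  qed
  moreover have "card ((if x = y then {} else {0}) \<union> Suc ` ?D) = (if x = y then 0 else 1) + card ?D"
    by (cases "x = y") (simp_all add: card_image card_insert_if image_iff)
  ultimately show ?case using Cons.IH by (simp only: hamming.simps)
qed simp

lemma even_hamming_iff: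
  "length u = length v \<Longrightarrow> even (hamming u v) \<longleftrightarrow> even_vertex u = even_vertex v"
  by (induction u v rule: list_induct2) (auto simp: even_vertex_def)

lemma adjacent_opposite:
  assumes "u \<in> cube n" "v \<in> cube n" "hamming u v = 1"
  shows "even_vertex v \<longleftrightarrow> \<not> even_vertex u"
  using even_hamming_iff[of u v] assms by (auto simp: cube_def)

text \<open>
  Flipping each coordinate gives \<open>n\<close> distinct neighbours.  The forbidden vertices come as a
  list because its length bounds their number even when they coincide.
\<close>

lemma neighbour_avoiding:
  assumes v: "v \<in> cube n" and xs: "length xs < n"
  obtains w where "w \<in> cube n" "hamming v w = 1" "w \<notin> set xs"
    "even_vertex w \<longleftrightarrow> \<not> even_vertex v"
proof -
  define flip where "flip i = v[i := \<not> v ! i]" for i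
  have len: "length v = n" using v by (simp add: cube_def)
  have dist: "hamming v (flip i) = 1" if "i < n" for i
  proof -
    have "{j. j < length (flip i) \<and> v ! j \<noteq> flip i ! j} = {i}"
      using that len by (auto simp: flip_def nth_list_update)
    then show ?thesis using hamming_conv_card[of v "flip i"] by (simp add: flip_def)
  qed
  have "inj_on flip {..<n}"
  proof (rule inj_onI)
    fix i j assume "i \<in> {..<n}" "j \<in> {..<n}" "flip i = flip j"
    then have "flip i ! i = flip j ! i" "i < length v" using len by simp_all
    then show "i = j" by (cases "j = i") (simp_all add: flip_def)
  qed
  then have "card (flip ` {..<n}) = n" by (simp add: card_image)
  then have "\<not> flip ` {..<n} \<subseteq> set xs"
    using xs card_length[of xs] card_mono[of "set xs" "flip ` {..<n}"] by auto
  then obtain i where i: "i < n" "flip i \<notin> set xs" by auto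
  have c: "flip i \<in> cube n" using len by (simp add: flip_def cube_def)
  show thesis using that[OF c dist[OF i(1)] i(2)] adjacent_opposite[OF v c dist[OF i(1)]] by simp
qed

section \<open>Vertex sets of paths\<close>

definition spans :: "bool list set \<Rightarrow> bool list \<Rightarrow> bool list \<Rightarrow> bool" where
  "spans A a b \<longleftrightarrow> (\<exists>p. p \<noteq> [] \<and> hd p = a \<and> last p = b \<and> distinct p \<and>
     successively (\<lambda>u v. hamming u v = 1) p \<and> set p = A)"

definition links :: "bool list set \<Rightarrow> bool list \<Rightarrow> bool list \<Rightarrow> bool list \<Rightarrow> bool list \<Rightarrow> bool" where
  "links V a b c d \<longleftrightarrow> (\<exists>A B. A \<inter> B = {} \<and> A \<union> B = V \<and> spans A a b \<and> spans B c d)"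

lemma spansI:
  assumes "p \<noteq> []" "hd p = a" "last p = b" "distinct p"
    "successively (\<lambda>u v. hamming u v = 1) p" "set p = A"
  shows "spans A a b"
  using assms by (auto simp: spans_def)

lemma spansE:
  assumes "spans A a b"
  obtains p where "p \<noteq> []" "hd p = a" "last p = b" "distinct p"
    "successively (\<lambda>u v. hamming u v = 1) p" "set p = A"
  using assms by (auto simp: spans_def)

lemma spans_singleton: "spans {a} a a"
  unfolding spans_def by (rule exI[of _ "[a]"]) simp

lemma spans_ends: "spans A a b \<Longrightarrow> a \<in> A \<and> b \<in> A"
  unfolding spans_def by (auto intro: hd_in_set last_in_set)

lemma spans_sym:
  assumes "spans A a b"
  shows "spans A b a"
proof -
  obtain p where p: "p \<noteq> []" "hd p = a" "last p = b" "distinct p"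
    "successively (\<lambda>u v. hamming u v = 1) p" "set p = A" by (rule spansE[OF assms])
  show ?thesis
    by (rule spansI[of "rev p"]) (use p 
      in \<open>auto simp: hd_rev last_rev hamming_sym elim: successively_mono\<close>)
qed

lemma spans_join:
  assumes A: "spans A a b" and B: "spans B c d" and AB: "A \<inter> B = {}" "hamming b c = 1"
  shows "spans (A \<union> B) a d"
proof -
  obtain p where p: "p \<noteq> []" "hd p = a" "last p = b" "distinct p"
    "successively (\<lambda>u v. hamming u v = 1) p" "set p = A" by (rule spansE[OF A])
  obtain q where q: "q \<noteq> []" "hd q = c" "last q = d" "distinct q"
    "successively (\<lambda>u v. hamming u v = 1) q" "set q = B" by (rule spansE[OF B])
  show ?thesis
    by (rule spansI[of "p @ q"]) (use p q AB in \<open>simp_all add: successively_append_iff\<close>)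
qed

lemma spans_snoc:
  assumes "spans A a b" "x \<notin> A" "hamming b x = 1"
  shows "spans (insert x A) a x"
  using spans_join[OF assms(1) spans_singleton[of x]] assms by simp

text \<open>
  A path is cut just before an interior vertex \<open>x\<close>; \<open>spans_cut_right\<close> cuts just after it.
\<close>

lemma spans_cut:
  assumes A: "spans A a b" and x: "x \<in> A" "x \<noteq> a"
  obtains B C u where "spans B a u" "spans C x b" "A = B \<union> C" "B \<inter> C = {}" "hamming u x = 1"
proof -
  obtain p where p: "p \<noteq> []" "hd p = a" "last p = b" "distinct p"
    "successively (\<lambda>u v. hamming u v = 1) p" "set p = A" by (rule spansE[OF A])
  obtain q r where pqr: "p = q @ x # r" using x p(6) by (metis split_list)
  have "q \<noteq> []" using pqr p(2) x by auto
  have 1: "spans (set q) a (last q)"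
    by (rule spansI[of q]) (use p \<open>q \<noteq> []\<close> in \<open>auto simp: pqr successively_append_iff\<close>)
  have 2: "spans (set (x # r)) x b"
    by (rule spansI[of "x # r"]) (use p in \<open>auto simp: pqr successively_append_iff\<close>)
  have 3: "hamming (last q) x = 1"
    using p(5) \<open>q \<noteq> []\<close> by (simp add: pqr successively_append_iff)
  have 4: "A = set q \<union> set (x # r)" "set q \<inter> set (x # r) = {}" using p(4,6) by (auto simp: pqr)
  show thesis by (rule that[OF 1 2 4 3])
qed

lemma links_swap:
  assumes "links V a b c d"
  shows "links V b a c d"
proof -
  obtain A B where "A \<inter> B = {}" "A \<union> B = V" "spans A a b" "spans B c d"
    using assms by (auto simp: links_def)
  then have "A \<inter> B = {} \<and> A \<union> B = V \<and> spans A b a \<and> spans B c d" by (simp add: spans_sym[of A a b])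
  then show ?thesis unfolding links_def by blast
qed

lemma links_flip:
  assumes "links V a b c d"
  shows "links V c d a b"
proof -
  obtain A B where "A \<inter> B = {}" "A \<union> B = V" "spans A a b" "spans B c d"
    using assms by (auto simp: links_def)
  then show ?thesis unfolding links_def by (intro exI[of _ B] exI[of _ A]) auto
qed

lemma spans_cut_right:
  assumes "spans A a b" "x \<in> A" "x \<noteq> b"
  obtains B C v where "spans B a x" "spans C v b" "A = B \<union> C" "B \<inter> C = {}" "hamming v x = 1"
proof -
  obtain C B v where 1: "spans C b v" "spans B x a" "A = C \<union> B" "C \<inter> B = {}" "hamming v x = 1"
    by (rule spans_cut[OF spans_sym[OF assms(1)] assms(2,3)])
  show thesis
    by (rule that[OF spans_sym[OF 1(2)] spans_sym[OF 1(1)] _ _ 1(5)]) (use 1 in auto)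
qed

text \<open>
  Cutting a path on the outer sides of two interior vertices \<open>c\<close> and \<open>d\<close> leaves a middle piece
  joining them.  The order in which the path meets \<open>c\<close> and \<open>d\<close> is not known, which accounts for the
  final disjunction.
\<close>

lemma spans_cut_out:
  assumes U: "spans U a b" and cd: "c \<in> U" "d \<in> U" "distinct [a, b, c, d]"
  obtains X Y Z u v where "spans X a u" "spans Z v b" "spans Y c d"
    "U = X \<union> Y \<union> Z" "X \<inter> Y = {}" "X \<inter> Z = {}" "Y \<inter> Z = {}"
    "hamming u c = 1 \<and> hamming v d = 1 \<or> hamming u d = 1 \<and> hamming v c = 1"
proof -
  have ne: "c \<noteq> a" "c \<noteq> b" "d \<noteq> a" "d \<noteq> b" using cd(3) by auto
  obtain B C u where bc: "spans B a u" "spans C c b" "U = B \<union> C" "B \<inter> C = {}" "hamming u c = 1"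
    by (rule spans_cut[OF U cd(1) ne(1)])
  show thesis
  proof (cases "d \<in> C")
    case True
    obtain Y Z v where yz: "spans Y c d" "spans Z v b" "C = Y \<union> Z" "Y \<inter> Z = {}" "hamming v d = 1"
      by (rule spans_cut_right[OF bc(2) True ne(4)])
    show thesis
      by (rule that[OF bc(1) yz(2) yz(1)]) (use bc yz in auto)
  next
    case False
    then have dB: "d \<in> B" using cd(2) bc(3) by simp
    obtain B1 B2 w where b: "spans B1 a w" "spans B2 d u" "B = B1 \<union> B2" "B1 \<inter> B2 = {}" "hamming w d = 1"
      by (rule spans_cut[OF bc(1) dB ne(3)])
    have db: "spans (B2 \<union> C) d b" by (rule spans_join[OF b(2) bc(2)]) (use b bc in auto)
    have cC: "c \<in> B2 \<union> C" using spans_ends[OF bc(2)] by simp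
    obtain Y Z v where yz: "spans Y d c" "spans Z v b" "B2 \<union> C = Y \<union> Z" "Y \<inter> Z = {}" "hamming v c = 1"
      by (rule spans_cut_right[OF db cC ne(2)])
    have U': "U = B1 \<union> (B2 \<union> C)" "B1 \<inter> (B2 \<union> C) = {}" using b bc by auto
    show thesis
      by (rule that[OF b(1) yz(2) spans_sym[OF yz(1)]])
        (use U'(2) b(5) yz(3-5) in \<open>auto simp: U'(1)\<close>)
  qed
qed

text \<open>
  The middle piece between \<open>c\<close> and \<open>d\<close> becomes the second path, and the outer pieces are
  reconnected through the disjoint set \<open>W\<close>.
\<close>

lemma links_detour:
  assumes U: "spans U a b" and cd: "c \<in> U" "d \<in> U" "distinct [a, b, c, d]"
    and W: "U \<inter> W = {}"
    and detour: "\<And>u v. u \<in> U \<Longrightarrow> v \<in> U \<Longrightarrow> u \<noteq> v \<Longrightarrow>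
      hamming u c = 1 \<or> hamming u d = 1 \<Longrightarrow> hamming v c = 1 \<or> hamming v d = 1 \<Longrightarrow>
      \<exists>u' v'. hamming u u' = 1 \<and> hamming v' v = 1 \<and> spans W u' v'"
  shows "links (U \<union> W) a b c d"
proof -
  obtain X Y Z u v where s: "spans X a u" "spans Z v b" "spans Y c d"
    "U = X \<union> Y \<union> Z" "X \<inter> Y = {}" "X \<inter> Z = {}" "Y \<inter> Z = {}"
    "hamming u c = 1 \<and> hamming v d = 1 \<or> hamming u d = 1 \<and> hamming v c = 1"
    by (rule spans_cut_out[OF U cd]) metis
  have "u \<in> X" "v \<in> Z" using s(1,2) spans_ends by auto
  then have "u \<in> U" "v \<in> U" "u \<noteq> v" using s by auto
  then obtain u' v' where "hamming u u' = 1" "hamming v' v = 1" "spans W u' v'"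
    using detour[of u v] s(8) by blast
  then have "spans (X \<union> W) a v'" "hamming v' v = 1" using spans_join[OF s(1)] W s by auto
  then have "spans (X \<union> W \<union> Z) a b" using spans_join[OF _ s(2)] W s by blast
  then show ?thesis unfolding links_def using s W
    by (intro exI[of _ "X \<union> W \<union> Z"] exI[of _ Y]) auto
qed

lemma links_extend:
  assumes "links U a b c x" "spans W y d" "U \<inter> W = {}" "hamming x y = 1"
  shows "links (U \<union> W) a b c d"
proof -
  obtain A B where A: "A \<inter> B = {}" "A \<union> B = U" "spans A a b" "spans B c x"
    using assms(1) by (auto simp: links_def)
  have "spans (B \<union> W) c d" using spans_join[OF A(4) assms(2)] assms A by blast
  then show ?thesis unfolding links_def using A assms(3)
    by (intro exI[of _ A] exI[of _ "B \<union> W"]) auto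
qed

lemma links_join:
  assumes "links U a x c y" "links W x' b y' d" "U \<inter> W = {}" "hamming x x' = 1" "hamming y y' = 1"
  shows "links (U \<union> W) a b c d"
proof -
  obtain A B where A: "A \<inter> B = {}" "A \<union> B = U" "spans A a x" "spans B c y"
    using assms(1) by (auto simp: links_def)
  obtain C D where C: "C \<inter> D = {}" "C \<union> D = W" "spans C x' b" "spans D y' d"
    using assms(2) by (auto simp: links_def)
  have "spans (A \<union> C) a b" "spans (B \<union> D) c d"
    using spans_join[OF A(3) C(3)] spans_join[OF A(4) C(4)] assms A C by blast+
  then show ?thesis unfolding links_def using A C assms(3)
    by (intro exI[of _ "A \<union> C"] exI[of _ "B \<union> D"]) auto
qed

section \<open>Isometries of the cube\<close>

definition isometry :: "nat \<Rightarrow> (bool list \<Rightarrow> bool list) \<Rightarrow> bool" where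
  "isometry n f \<longleftrightarrow> (\<forall>v\<in>cube n. f v \<in> cube n) \<and>
     (\<forall>u\<in>cube n. \<forall>v\<in>cube n. hamming (f u) (f v) = hamming u v)"

lemma isometry_inj: "isometry n f \<Longrightarrow> inj_on f (cube n)"
  unfolding isometry_def inj_on_def
  by (metis (mono_tags, lifting) cube_def hamming_eq_0_iff hamming_self mem_Collect_eq)

lemma isometry_bij: "isometry n f \<Longrightarrow> bij_betw f (cube n) (cube n)"
  using isometry_inj[of n f] endo_inj_surj[OF finite_cube, of f n]
  by (auto simp: isometry_def bij_betw_def)

text \<open>
  An isometry permutes the finite cube, so its inverse is one as well.  This is what allows
  positions to be normalised: a linkage of the normalised position is carried back.
\<close>

lemma isometry_inverse:
  assumes "isometry n f"
  shows "isometry n (inv_into (cube n) f)"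
proof -
  let ?g = "inv_into (cube n) f"
  have im: "f ` cube n = cube n" using isometry_bij[OF assms] by (simp add: bij_betw_def)
  have g: "?g v \<in> cube n \<and> f (?g v) = v" if "v \<in> cube n" for v
    using that im by (metis f_inv_into_f inv_into_into)
  then show ?thesis using assms unfolding isometry_def by metis
qed

lemma isometry_comp: "isometry n f \<Longrightarrow> isometry n g \<Longrightarrow> isometry n (f \<circ> g)"
  by (simp add: isometry_def)

lemma isometry_same_parity:
  assumes "isometry n f" "u \<in> cube n" "v \<in> cube n"
  shows "even_vertex (f u) = even_vertex (f v) \<longleftrightarrow> even_vertex u = even_vertex v"
  using assms even_hamming_iff[of u v] even_hamming_iff[of "f u" "f v"]
  by (auto simp: isometry_def cube_def)

lemma spans_isometry:
  assumes f: "isometry n f" and A: "spans A a b" "A \<subseteq> cube n"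
  shows "spans (f ` A) (f a) (f b)"
proof -
  obtain p where p: "p \<noteq> []" "hd p = a" "last p = b" "distinct p"
    "successively (\<lambda>u v. hamming u v = 1) p" "set p = A" by (rule spansE[OF A(1)])
  have "successively (\<lambda>u v. hamming (f u) (f v) = 1) p"
    using p(5) by (rule successively_mono) (use p A f in \<open>auto simp: isometry_def subset_iff\<close>)
  moreover have "inj_on f (set p)" using isometry_inj[OF f] inj_on_subset A(2) p(6) by metis
  ultimately show ?thesis unfolding spans_def using p
    by (intro exI[of _ "map f p"])
      (auto simp: hd_map last_map distinct_map successively_map)
qed

lemma links_isometry:
  assumes f: "isometry n f" and l: "links (cube n - {r, s}) a b c d" and rs: "{r, s} \<subseteq> cube n"
  shows "links (cube n - {f r, f s}) (f a) (f b) (f c) (f d)"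
proof -
  obtain A B where A: "A \<inter> B = {}" "A \<union> B = cube n - {r, s}" "spans A a b" "spans B c d"
    using l by (auto simp: links_def)
  have AB: "A \<subseteq> cube n" "B \<subseteq> cube n" using A(2) by auto
  have bij: "inj_on f (cube n)" "f ` cube n = cube n"
    using isometry_bij[OF f] by (auto simp: bij_betw_def)
  have "f ` A \<inter> f ` B = {}" using inj_on_image_Int[OF bij(1) AB] A(1) by simp
  moreover have "f ` A \<union> f ` B = cube n - {f r, f s}"
    using inj_on_image_set_diff[OF bij(1) _ rs, of "cube n"] A(2) bij(2) by (auto simp: image_Un[symmetric])
  ultimately show ?thesis unfolding links_def
    using spans_isometry[OF f A(3) AB(1)] spans_isometry[OF f A(4) AB(2)] by blast
qed

lemma links_isometry_iff:
  assumes f: "isometry n f" and V: "{r, s, a, b, c, d} \<subseteq> cube n"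
  shows "links (cube n - {f r, f s}) (f a) (f b) (f c) (f d) \<longleftrightarrow> links (cube n - {r, s}) a b c d"
proof
  let ?g = "inv_into (cube n) f"
  have g: "?g (f v) = v" if "v \<in> cube n" for v
    using that isometry_inj[OF f] by simp
  have "{f r, f s} \<subseteq> cube n" using f V by (auto simp: isometry_def)
  moreover assume "links (cube n - {f r, f s}) (f a) (f b) (f c) (f d)"
  ultimately show "links (cube n - {r, s}) a b c d"
    using links_isometry[OF isometry_inverse[OF f], of "f r" "f s" "f a" "f b" "f c" "f d"] g V by simp
qed (use links_isometry[OF f] V in simp)

definition permute :: "nat list \<Rightarrow> bool list \<Rightarrow> bool list" where
  "permute \<pi> v = map ((!) v) \<pi>"

definition translate :: "bool list \<Rightarrow> bool list \<Rightarrow> bool list" where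
  "translate m v = map2 (\<noteq>) m v"

lemma isometry_permute:
  assumes "distinct \<pi>" "set \<pi> = {..<n}"
  shows "isometry n (permute \<pi>)"
proof -
  have len: "length \<pi> = n" using distinct_card[OF assms(1)] assms(2) by simp
  have "hamming (permute \<pi> u) (permute \<pi> v) = hamming u v" if "length u = n" "length v = n" for u v
  proof -
    have "bij_betw ((!) \<pi>) {i. i < n \<and> u ! (\<pi> ! i) \<noteq> v ! (\<pi> ! i)} {i. i < n \<and> u ! i \<noteq> v ! i}"
    proof (rule bij_betw_subset[of _ "{..<n}" "{..<n}"])
      show b: "bij_betw ((!) \<pi>) {..<n} {..<n}" using assms len by (intro bij_betw_nth) auto
      show "(!) \<pi> ` {i. i < n \<and> u ! (\<pi> ! i) \<noteq> v ! (\<pi> ! i)} = {i. i < n \<and> u ! i \<noteq> v ! i}"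
        using b by (auto simp: bij_betw_def image_iff)
    qed auto
    then have "card {i. i < n \<and> u ! (\<pi> ! i) \<noteq> v ! (\<pi> ! i)} = card {i. i < n \<and> u ! i \<noteq> v ! i}"
      by (rule bij_betw_same_card)
    moreover have "{i. i < n \<and> u ! (\<pi> ! i) \<noteq> v ! (\<pi> ! i)} =
       {i. i < n \<and> permute \<pi> u ! i \<noteq> permute \<pi> v ! i}"
      using len by (auto simp: permute_def)
    ultimately show ?thesis using that len hamming_conv_card[of u v]
      hamming_conv_card[of "permute \<pi> u" "permute \<pi> v"] by (simp add: permute_def)
  qed
  then show ?thesis using len by (auto simp: isometry_def cube_def permute_def)
qed

lemma isometry_translate:
  assumes "m \<in> cube n"
  shows "isometry n (translate m)"
proof -
  have "hamming (translate m u) (translate m v) = hamming u v"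
    if "length u = length m" "length v = length u" for u v
    using that
    by (induction m arbitrary: u v) (auto simp: translate_def length_Suc_conv)
  then show ?thesis using assms by (auto simp: isometry_def cube_def translate_def)
qed

section \<open>From one dimension to the next\<close>

text \<open>
  \<open>r\<close> and \<open>s\<close> are the deleted vertices, and the four ends have the opposite parity.
\<close>

definition balanced ::
    "nat \<Rightarrow> bool list \<Rightarrow> bool list \<Rightarrow> bool list \<Rightarrow> bool list \<Rightarrow> bool list \<Rightarrow> bool list \<Rightarrow> bool" where
  "balanced n r s a b c d \<longleftrightarrow> {r, s, a, b, c, d} \<subseteq> cube n \<and> r \<noteq> s \<and> distinct [a, b, c, d] \<and>
     even_vertex s = even_vertex r \<and> (\<forall>g\<in>{a, b, c, d}. even_vertex g \<longleftrightarrow> \<not> even_vertex r)"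

definition linkable :: "nat \<Rightarrow> bool" where
  "linkable n \<longleftrightarrow> (\<forall>r s a b c d. balanced n r s a b c d \<longrightarrow> links (cube n - {r, s}) a b c d)"

text \<open>
  Delete a further vertex \<open>x\<close> of the parity of \<open>r\<close>, and let \<open>y\<close>, \<open>z\<close> be two neighbours of \<open>x\<close>
  different from \<open>a\<close> and \<open>b\<close>.  Disjoint paths from \<open>a\<close> to \<open>y\<close> and from \<open>z\<close> to \<open>b\<close>
  are joined by \<open>x\<close>.
\<close>

lemma spans_cube_minus:
  assumes P: "linkable n" and n: "n \<ge> 4"
    and V: "{r, a, b} \<subseteq> cube n" "a \<noteq> b"
    and par: "\<forall>g\<in>{a, b}. even_vertex g \<longleftrightarrow> \<not> even_vertex r"
  shows "spans (cube n - {r}) a b"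
proof -
  have r: "r \<in> cube n" and len: "length [] < n" "length [r] < n" "length [a, b] < n" "length [a, b, v] < n" for v
    using V n by simp_all
  obtain w where w: "w \<in> cube n" "hamming r w = 1" "w \<notin> set []" "even_vertex w \<longleftrightarrow> \<not> even_vertex r"
    by (rule neighbour_avoiding[OF r len(1)])
  obtain x where x: "x \<in> cube n" "hamming w x = 1" "x \<notin> set [r]" "even_vertex x \<longleftrightarrow> \<not> even_vertex w"
    by (rule neighbour_avoiding[OF w(1) len(2)])
  obtain y where
    y: "y \<in> cube n" "hamming x y = 1" "y \<notin> set [a, b]" "even_vertex y \<longleftrightarrow> \<not> even_vertex x"
    by (rule neighbour_avoiding[OF x(1) len(3)])
  obtain z where
    z: "z \<in> cube n" "hamming x z = 1" "z \<notin> set [a, b, y]" "even_vertex z \<longleftrightarrow> \<not> even_vertex x"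
    by (rule neighbour_avoiding[OF x(1) len(4)])
  have "balanced n r x a y z b" using V par w x y z by (auto simp: balanced_def)
  then have "links (cube n - {r, x}) a y z b" using P by (simp add: linkable_def)
  then obtain A B where A: "A \<inter> B = {}" "A \<union> B = cube n - {r, x}" "spans A a y" "spans B z b"
    by (auto simp: links_def)
  have "spans (insert x A) a x" using spans_snoc[OF A(3)] A(2) y(2) hamming_sym by auto
  then have "spans (insert x A \<union> B) a b" using spans_join[OF _ A(4)] A z(2) by blast
  moreover have "insert x A \<union> B = cube n - {r}" using A(2) x by auto
  ultimately show ?thesis by simp
qed

text \<open>
  Delete \<open>x\<close> as well and end the second path in a neighbour of \<open>x\<close> other than \<open>a\<close>, \<open>b\<close>,
  \<open>c\<close>.  One of the at least four neighbours of \<open>x\<close> is left.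
\<close>

lemma links_cube_minus:
  assumes P: "linkable n" and n: "n \<ge> 4"
    and V: "{r, x, a, b, c} \<subseteq> cube n" "distinct [a, b, c]" "x \<noteq> r"
    and par: "even_vertex x = even_vertex r" "\<forall>g\<in>{a, b, c}. even_vertex g \<longleftrightarrow> \<not> even_vertex r"
  shows "links (cube n - {r}) a b c x"
proof -
  have "x \<in> cube n" "length [a, b, c] < n" using V n by simp_all
  then obtain y where y: "y \<in> cube n" "hamming x y = 1" "y \<notin> set [a, b, c]"
    "even_vertex y \<longleftrightarrow> \<not> even_vertex x"
    by (rule neighbour_avoiding)
  have "balanced n r x a b c y" using V par y by (auto simp: balanced_def)
  then have "links (cube n - {r, x}) a b c y" using P by (simp add: linkable_def)
  then have "links ((cube n - {r, x}) \<union> {x}) a b c x"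
    by (rule links_extend[OF _ spans_singleton]) (use y hamming_sym in auto)
  moreover have "(cube n - {r, x}) \<union> {x} = cube n - {r}" using V by auto
  ultimately show ?thesis by simp
qed

lemma spans_Cons: "spans A a b \<Longrightarrow> spans (Cons t ` A) (t # a) (t # b)"
  unfolding spans_def
proof (elim exE)
  fix p assume "p \<noteq> [] \<and> hd p = a \<and> last p = b \<and> distinct p \<and>
     successively (\<lambda>u v. hamming u v = 1) p \<and> set p = A"
  then show "\<exists>q. q \<noteq> [] \<and> hd q = t # a \<and> last q = t # b \<and> distinct q \<and>
     successively (\<lambda>u v. hamming u v = 1) q \<and> set q = Cons t ` A"
    by (intro exI[of _ "map (Cons t) p"])
      (auto simp: hd_map last_map distinct_map successively_map)
qed

lemma links_Cons: "links V a b c d \<Longrightarrow> links (Cons t ` V) (t # a) (t # b) (t # c) (t # d)"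
  unfolding links_def
proof (elim exE conjE)
  fix A B assume "A \<inter> B = {}" "A \<union> B = V" "spans A a b" "spans B c d"
  then show "\<exists>A B. A \<inter> B = {} \<and> A \<union> B = Cons t ` V \<and>
      spans A (t # a) (t # b) \<and> spans B (t # c) (t # d)"
    by (intro exI[of _ "Cons t ` A"] exI[of _ "Cons t ` B"]) (auto intro: spans_Cons)
qed

lemma even_vertex_Nil [simp]: "even_vertex []"
  by (simp add: even_vertex_def)

lemma even_vertex_Cons [simp]: "even_vertex (t # v) \<longleftrightarrow> (if t then \<not> even_vertex v else even_vertex v)"
  by (simp add: even_vertex_def)

lemma balanced_sym:
  assumes "balanced n r s a b c d"
  shows "balanced n s r a b c d" "balanced n r s b a c d" "balanced n r s c d a b"
  using assms by (auto simp: balanced_def)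

text \<open>
  In the following four lemmas \<open>t\<close> is the half that contains \<open>r\<close>, and \<open>t'\<close> the one that
  contains \<open>s\<close>; the numbers say how many ends lie in each.
  
  All ends in one half: a path from \<open>a\<close> to \<open>b\<close> through that half passes \<open>c\<close> and \<open>d\<close>.  It is
  left before the first and rejoined after the second of them, by way of the other half.  The
  vertices where it leaves and returns have the parity of \<open>r\<close>, hence their partners in the other
  half have the parity opposite to \<open>s\<close>.
\<close>

lemma split_4_0:
  assumes P: "linkable n" and n: "n \<ge> 4" and t: "t' \<noteq> t"
    and bal: "balanced (Suc n) (t # r) (t' # s) (t # a) (t # b) (t # c) (t # d)"
  shows "links (cube (Suc n) - {t # r, t' # s}) (t # a) (t # b) (t # c) (t # d)"
unfolding cube_Suc_minus[OF t]
proof (rule links_detour)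
  have V: "{r, s, a, b, c, d} \<subseteq> cube n" "distinct [a, b, c, d]" "even_vertex s \<longleftrightarrow> \<not> even_vertex r"
    "\<forall>g\<in>{a, b, c, d}. even_vertex g \<longleftrightarrow> \<not> even_vertex r"
    using bal t by (auto simp: balanced_def cube_def split: if_splits)
  show "spans (Cons t ` (cube n - {r})) (t # a) (t # b)"
    by (rule spans_Cons) (use spans_cube_minus[OF P n] V in auto)
  show "t # c \<in> Cons t ` (cube n - {r})" "t # d \<in> Cons t ` (cube n - {r})" using V by auto
  show "distinct [t # a, t # b, t # c, t # d]" using V by simp
  fix u v
  assume uv: "u \<in> Cons t ` (cube n - {r})" "v \<in> Cons t ` (cube n - {r})" "u \<noteq> v"
    "hamming u (t # c) = 1 \<or> hamming u (t # d) = 1" "hamming v (t # c) = 1 \<or> hamming v (t # d) = 1"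
  obtain u' v' where u': "u = t # u'" "v = t # v'" "u' \<in> cube n" "v' \<in> cube n" "u' \<noteq> v'"
    using uv(1-3) by auto
  have "even_vertex u' = even_vertex r" "even_vertex v' = even_vertex r"
    using uv u' V adjacent_opposite[of u' n] adjacent_opposite[of v' n] by auto
  then have "spans (Cons t' ` (cube n - {s})) (t' # u') (t' # v')"
    by (intro spans_Cons spans_cube_minus[OF P n]) (use V u' in auto)
  then show "\<exists>u' v'. hamming u u' = 1 \<and> hamming v' v = 1 \<and> spans (Cons t' ` (cube n - {s})) u' v'"
    using u' by (intro exI[of _ "t' # u'"] exI[of _ "t' # v'"]) (use t in auto)
qed (use t in auto)

text \<open>
  The lonely end \<open>d\<close> is reached from a vertex \<open>x\<close>: one path of the first half ends in \<open>x\<close>, and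
  the other half is traversed from the partner of \<open>x\<close> to \<open>d\<close>.
\<close>

lemma split_3_1:
  assumes P: "linkable n" and n: "n \<ge> 4" and t: "t' \<noteq> t"
    and bal: "balanced (Suc n) (t # r) (t' # s) (t # a) (t # b) (t # c) (t' # d)"
  shows "links (cube (Suc n) - {t # r, t' # s}) (t # a) (t # b) (t # c) (t' # d)"
proof -
  have V: "{r, s, a, b, c, d} \<subseteq> cube n" "distinct [a, b, c]" "even_vertex s \<longleftrightarrow> \<not> even_vertex r"
    "\<forall>g\<in>{a, b, c}. even_vertex g \<longleftrightarrow> \<not> even_vertex r" "even_vertex d = even_vertex r"
    using bal t by (auto simp: balanced_def cube_def split: if_splits)
  have "s \<in> cube n" "length [d, r] < n" using V n by simp_all
  then obtain x where x: "x \<in> cube n" "hamming s x = 1" "x \<notin> set [d, r]"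
    "even_vertex x \<longleftrightarrow> \<not> even_vertex s"
    by (rule neighbour_avoiding)
  show ?thesis
    unfolding cube_Suc_minus[OF t]
  proof (rule links_extend)
    show "links (Cons t ` (cube n - {r})) (t # a) (t # b) (t # c) (t # x)"
      by (rule links_Cons, rule links_cube_minus[OF P n]) (use V x in auto)
    show "spans (Cons t' ` (cube n - {s})) (t' # x) (t' # d)"
      by (intro spans_Cons spans_cube_minus[OF P n]) (use V x in auto)
  qed (use t in auto)
qed

lemma split_2_2_straight:
  assumes P: "linkable n" and n: "n \<ge> 4" and t: "t' \<noteq> t"
    and bal: "balanced (Suc n) (t # r) (t' # s) (t # a) (t # b) (t' # c) (t' # d)"
  shows "links (cube (Suc n) - {t # r, t' # s}) (t # a) (t # b) (t' # c) (t' # d)"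
proof -
  have V: "{r, s, a, b, c, d} \<subseteq> cube n" "a \<noteq> b" "c \<noteq> d" "even_vertex s \<longleftrightarrow> \<not> even_vertex r"
    "\<forall>g\<in>{a, b}. even_vertex g \<longleftrightarrow> \<not> even_vertex r" "\<forall>g\<in>{c, d}. even_vertex g = even_vertex r"
    using bal t by (auto simp: balanced_def cube_def split: if_splits)
  have "spans (Cons t ` (cube n - {r})) (t # a) (t # b)" "spans (Cons t' ` (cube n - {s})) (t' # c) (t' # d)"
    by (rule spans_Cons, rule spans_cube_minus[OF P n]; use V in auto)+
  moreover have "Cons t ` (cube n - {r}) \<inter> Cons t' ` (cube n - {s}) = {}" using t by auto
  ultimately show ?thesis unfolding links_def cube_Suc_minus[OF t] by blast
qed

text \<open>
  Both paths have to change halves, one of them at a vertex \<open>x\<close> with the parity of the ends,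
  the other one at a vertex \<open>y\<close> with the parity of \<open>r\<close>.  In either half there is then one path
  between vertices of equal parity and one between vertices of opposite parity.
\<close>

lemma split_2_2_cross:
  assumes P: "linkable n" and n: "n \<ge> 4" and t: "t' \<noteq> t"
    and bal: "balanced (Suc n) (t # r) (t' # s) (t # a) (t' # b) (t # c) (t' # d)"
  shows "links (cube (Suc n) - {t # r, t' # s}) (t # a) (t' # b) (t # c) (t' # d)"
proof -
  have V: "{r, s, a, b, c, d} \<subseteq> cube n" "a \<noteq> c" "b \<noteq> d" "even_vertex s \<longleftrightarrow> \<not> even_vertex r"
    "\<forall>g\<in>{a, c}. even_vertex g \<longleftrightarrow> \<not> even_vertex r" "\<forall>g\<in>{b, d}. even_vertex g = even_vertex r"
    using bal t by (auto simp: balanced_def cube_def split: if_splits)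
  have rs: "r \<in> cube n" "s \<in> cube n" and len: "length [u, v, w] < n" for u v w :: "bool list"
    using V n by simp_all
  obtain x where x: "x \<in> cube n" "hamming r x = 1" "x \<notin> set [a, c, s]"
    "even_vertex x \<longleftrightarrow> \<not> even_vertex r"
    by (rule neighbour_avoiding[OF rs(1) len])
  obtain y where y: "y \<in> cube n" "hamming s y = 1" "y \<notin> set [b, d, r]"
    "even_vertex y \<longleftrightarrow> \<not> even_vertex s"
    by (rule neighbour_avoiding[OF rs(2) len])
  show ?thesis
    unfolding cube_Suc_minus[OF t]
  proof (rule links_join)
    show "links (Cons t ` (cube n - {r})) (t # a) (t # x) (t # c) (t # y)"
      by (rule links_Cons, rule links_cube_minus[OF P n]) (use V x y in auto)
    show "links (Cons t' ` (cube n - {s})) (t' # x) (t' # b) (t' # y) (t' # d)"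
      by (rule links_Cons, rule links_swap, rule links_flip, rule links_cube_minus[OF P n])
        (use V x y in auto)
  qed (use t in auto)
qed

text \<open>
  The remaining distributions arise from these by exchanging the paths, their directions and
  the halves.
\<close>

lemma split_from_near:
  assumes P: "linkable n" and n: "n \<ge> 4" and t: "t' \<noteq> t"
    and bal: "balanced (Suc n) (t # r) (t' # s) (t # a) (tb # b) (tc # c) (td # d)"
  shows "links (cube (Suc n) - {t # r, t' # s}) (t # a) (tb # b) (tc # c) (td # d)"
proof -
  note split = split_4_0[OF P n t] split_3_1[OF P n t] split_2_2_straight[OF P n t] split_2_2_cross[OF P n t]
  have far: "x = t'" if "x \<noteq> t" for x using that t by simp
  show ?thesis
  proof (cases "tb = t")
    case b: True
    show ?thesis
    proof (cases "tc = t")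
      case c: True
      show ?thesis
      proof (cases "td = t")
        case True
        then show ?thesis using split(1) bal b c by simp
      next
        case False
        then show ?thesis using split(2) bal b c far by simp
      qed
    next
      case c: False
      show ?thesis
      proof (cases "td = t")
        case True
        have "balanced (Suc n) (t # r) (t' # s) (t # a) (t # b) (t # d) (t' # c)"
          using bal b far[OF c] True by (auto simp: balanced_def)
        from links_flip[OF links_swap[OF links_flip[OF split(2)[OF this]]]] show ?thesis
          using b far[OF c] True by simp
      next
        case False
        then show ?thesis using split(3) bal b c far by simp
      qed
    qed
  next
    case b: False
    show ?thesis
    proof (cases "tc = t")
      case c: True
      show ?thesis
      proof (cases "td = t")
        case True
        have "balanced (Suc n) (t # r) (t' # s) (t # c) (t # d) (t # a) (t' # b)"
          using bal c far[OF b] True by (auto simp: balanced_def)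
        from links_flip[OF split(2)[OF this]] show ?thesis
          using c far[OF b] True by simp
      next
        case False
        then show ?thesis using split(4) bal b c far by simp
      qed
    next
      case c: False
      show ?thesis
      proof (cases "td = t")
        case True
        have "balanced (Suc n) (t # r) (t' # s) (t # a) (t' # b) (t # d) (t' # c)"
          using bal far[OF b] far[OF c] True by (auto simp: balanced_def)
        from links_flip[OF links_swap[OF links_flip[OF split(4)[OF this]]]] show ?thesis
          using far[OF b] far[OF c] True by simp
      next
        case d: False
        have "balanced (Suc n) (t' # s) (t # r) (t' # c) (t' # d) (t' # b) (t # a)"
          using bal far[OF b] far[OF c] far[OF d] by (auto simp: balanced_def)
        from links_swap[OF links_flip[OF split_3_1[OF P n t[symmetric] this]]] show ?thesis
          using far[OF b] far[OF c] far[OF d] by (simp add: insert_commute)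
      qed
    qed
  qed
qed

lemma isometry_balanced:
  assumes f: "isometry n f" and bal: "balanced n r s a b c d"
  shows "balanced n (f r) (f s) (f a) (f b) (f c) (f d)"
proof -
  have V: "{r, s, a, b, c, d} \<subseteq> cube n" using bal by (simp add: balanced_def)
  have im: "f v \<in> cube n" if "v \<in> cube n" for v using f that by (simp add: isometry_def)
  have eq: "f u = f v \<longleftrightarrow> u = v" if "u \<in> cube n" "v \<in> cube n" for u v
    using that inj_on_eq_iff[OF isometry_inj[OF f]] by blast
  have par: "even_vertex (f v) = even_vertex (f r) \<longleftrightarrow> even_vertex v = even_vertex r"
    if "v \<in> cube n" for v
    using isometry_same_parity[OF f that, of r] V by auto
  have "even_vertex (f s) = even_vertex (f r)"
    "\<forall>g\<in>{a, b, c, d}. even_vertex (f g) \<longleftrightarrow> \<not> even_vertex (f r)"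
    using bal V par[of s] par[of a] par[of b] par[of c] par[of d] by (simp_all add: balanced_def)
  then show ?thesis using bal V im eq unfolding balanced_def by simp
qed

text \<open>
  A permutation of the coordinates moves one in which \<open>r\<close> and \<open>s\<close> differ to the front.
\<close>

lemma linkable_Suc:
  assumes P: "linkable n" and n: "n \<ge> 4"
  shows "linkable (Suc n)"
  unfolding linkable_def
proof (intro allI impI)
  fix r s a b c d assume bal: "balanced (Suc n) r s a b c d"
  then have V: "{r, s, a, b, c, d} \<subseteq> cube (Suc n)" "r \<noteq> s" by (simp_all add: balanced_def)
  then obtain i where i: "i < Suc n" "r ! i \<noteq> s ! i"
    by (auto simp: cube_def list_eq_iff_nth_eq)
  define f where "f = permute (i # filter (\<lambda>j. j \<noteq> i) [0..<Suc n])"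
  have f: "isometry (Suc n) f" unfolding f_def
    by (rule isometry_permute) (use i in auto)
  obtain F where F: "f v = v ! i # F v" for v by (simp add: f_def permute_def)
  have bal': "balanced (Suc n) (r ! i # F r) (s ! i # F s) (a ! i # F a) (b ! i # F b) (c ! i # F c) (d ! i # F d)"
    using isometry_balanced[OF f bal] by (simp only: F)
  have "links (cube (Suc n) - {f r, f s}) (f a) (f b) (f c) (f d)"
  proof (cases "a ! i = r ! i")
    case True
    then show ?thesis
      using split_from_near[OF P n i(2)[symmetric]] bal' by (simp only: F)
  next
    case False
    then have "a ! i = s ! i" using i by auto
    then have "links (cube (Suc n) - {f s, f r}) (f a) (f b) (f c) (f d)"
      using split_from_near[OF P n i(2)] balanced_sym(1)[OF bal'] by (simp only: F)
    then show ?thesis by (simp add: insert_commute)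
  qed
  then show "links (cube (Suc n) - {r, s}) a b c d" using links_isometry_iff[OF f V(1)] by simp
qed

section \<open>Dimension four\<close>

text \<open>
  The binary digits of the code, least significant one first.
\<close>

definition vertex :: "nat \<Rightarrow> bool list" where
  "vertex k = [odd k, odd (k div 2), odd (k div 4), odd (k div 8)]"

text \<open>
  The lexicographic order.  Its only purpose is to single out one of the eight ways of listing
  two unordered pairs of ends.
\<close>

fun precedes :: "bool list \<Rightarrow> bool list \<Rightarrow> bool" where
  "precedes (x # xs) (y # ys) \<longleftrightarrow> (if x = y then precedes xs ys else y)"
| "precedes _ _ \<longleftrightarrow> False"

lemma precedes_total: "length u = length v \<Longrightarrow> u \<noteq> v \<Longrightarrow> precedes u v \<or> precedes v u"
  by (induction u v rule: list_induct2) auto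

fun sort_ends where
  "sort_ends (a, b, c, d) =
     (let (a', b') = (if precedes a b then (a, b) else (b, a));
          (c', d') = (if precedes c d then (c, d) else (d, c))
      in if precedes a' c' then (a', b', c', d') else (c', d', a', b'))"

fun map_ends where
  "map_ends f (a, b, c, d) = (f a, f b, f c, f d)"

fun key :: "bool list \<times> bool list \<times> bool list \<times> bool list \<Rightarrow> bool list" where
  "key (a, b, c, d) = a @ b @ c @ d"

text \<open>
  Inclusion between lists of bit strings is decided one bit at a time, splitting both lists by
  their first bits as in a radix sort.  The work is then proportional to the total length of
  the strings and not to the product of the lengths of the lists, which matters for evaluation by
  rewriting.
\<close>

fun behind :: "bool \<Rightarrow> bool list list \<Rightarrow> bool list list" where
  "behind b [] = []"
| "behind b ([] # xss) = behind b xss"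
| "behind b ((x # xs) # xss) = (if x = b then xs # behind b xss else behind b xss)"

fun radix_subset :: "nat \<Rightarrow> bool list list \<Rightarrow> bool list list \<Rightarrow> bool" where
  "radix_subset 0 xss yss \<longleftrightarrow> xss = [] \<or> (yss \<noteq> [] \<and> hd yss = [])"
| "radix_subset (Suc n) xss yss \<longleftrightarrow> (if xss = [] then True else
     radix_subset n (behind True xss) (behind True yss) \<and>
     radix_subset n (behind False xss) (behind False yss))"

lemma set_behind: "xs \<in> set (behind b xss) \<longleftrightarrow> b # xs \<in> set xss"
  by (induction b xss rule: behind.induct) auto

lemma radix_subset_sound:
  "radix_subset n xss yss \<Longrightarrow> xs \<in> set xss \<Longrightarrow> length xs = n \<Longrightarrow> xs \<in> set yss"
proof (induction n arbitrary: xs xss yss)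
  case 0
  then show ?case by (cases yss) auto
next
  case (Suc n)
  from Suc.prems(3) obtain b ys where xs: "xs = b # ys" "length ys = n" by (cases xs) simp_all
  have "xss \<noteq> []" using Suc.prems(2) by auto
  then have "radix_subset n (behind b xss) (behind b yss)"
    using Suc.prems(1) by (cases b) auto
  then show ?case using Suc.IH[of "behind b xss" "behind b yss" ys] Suc.prems(2) xs
    by (simp add: set_behind)
qed

text \<open>
  The two paths have 14 distinct vertices outside a set of two vertices in a cube of 16, so
  they cover without this being checked vertex by vertex.
\<close>

definition covering_ok :: "bool list \<Rightarrow> bool list list \<Rightarrow> bool list list \<Rightarrow> bool" where
  "covering_ok s p q \<longleftrightarrow> p \<noteq> [] \<and> q \<noteq> [] \<and>
     successively (\<lambda>u v. hamming u v = 1) p \<and> successively (\<lambda>u v. hamming u v = 1) q \<and>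
     distinct ([vertex 0, s] @ p @ q) \<and> length (p @ q) = 14 \<and> list_all (\<lambda>v. length v = 4) (p @ q)"

text \<open>
  The permutations of the coordinates that fix \<open>s\<close>.  They also fix the zero vertex, and
  translation by \<open>s\<close> exchanges \<open>s\<close> and zero, so these generate symmetries of the cube with the
  deleted pair.
\<close>

definition stabilizer :: "bool list \<Rightarrow> nat list list" where
  "stabilizer s = filter (\<lambda>\<pi>. distinct \<pi> \<and> permute \<pi> s = s) (List.n_lists 4 [0, 1, 2, 3])"

definition orbit_ends where
  "orbit_ends s T =
     (let E = map (\<lambda>(p, q). map_ends vertex (hd p, last p, hd q, last q)) T
      in concat (map (\<lambda>\<pi>. concat (map (\<lambda>e. let e' = map_ends (permute \<pi>) e
        in [sort_ends e', sort_ends (map_ends (translate s) e')]) E)) (stabilizer s)))"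

definition odd_vertices :: "bool list list" where
  "odd_vertices = map vertex [1, 2, 4, 7, 8, 11, 13, 14]"

definition sorted_odd_ends where
  "sorted_odd_ends = (let g = odd_vertices in [(a, b, c, d). a \<leftarrow> g, b \<leftarrow> g, precedes a b,
      c \<leftarrow> g, precedes a c, c \<noteq> b, d \<leftarrow> g, precedes c d, d \<noteq> b])"

text \<open>
  One covering for each orbit of positions of the ends, where the deleted vertices have codes 0
  and 3.
\<close>

definition near_coverings :: "(nat list \<times> nat list) list" where
  "near_coverings = [
    ([1, 5, 13, 12, 14, 15, 11, 9, 8, 10, 2], [4, 6, 7]),
    ([1, 5, 7, 6, 2], [4, 12, 13, 15, 14, 10, 11, 9, 8]),
    ([1, 5, 7, 6, 2], [4, 12, 13, 15, 14, 10, 8, 9, 11]),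
    ([1, 5, 7, 6, 2], [4, 12, 14, 15, 11, 10, 8, 9, 13]),
    ([1, 5, 4, 6, 7, 15, 11, 10, 2], [13, 9, 8, 12, 14]),
    ([1, 5, 4], [2, 6, 14, 12, 13, 9, 8, 10, 11, 15, 7]),
    ([1, 5, 4], [2, 6, 7, 15, 14, 12, 13, 9, 11, 10, 8]),
    ([1, 5, 4], [2, 6, 7, 15, 14, 12, 13, 9, 8, 10, 11]),
    ([1, 5, 4], [2, 6, 7, 15, 14, 12, 8, 10, 11, 9, 13]),
    ([1, 5, 4], [2, 6, 7, 15, 13, 12, 8, 9, 11, 10, 14]),
    ([1, 5, 4], [7, 6, 2, 10, 11, 9, 13, 15, 14, 12, 8]),
    ([1, 5, 4], [7, 6, 2, 10, 8, 9, 13, 12, 14, 15, 11]),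
    ([1, 5, 4], [7, 6, 2, 10, 11, 9, 8, 12, 14, 15, 13]),
    ([1, 5, 4], [7, 6, 2, 10, 11, 9, 8, 12, 13, 15, 14]),
    ([1, 5, 4], [8, 9, 13, 12, 14, 15, 7, 6, 2, 10, 11]),
    ([1, 5, 4], [8, 9, 11, 10, 2, 6, 7, 15, 14, 12, 13]),
    ([1, 5, 4], [8, 9, 11, 10, 2, 6, 7, 15, 13, 12, 14]),
    ([1, 5, 4], [11, 10, 2, 6, 7, 15, 14, 12, 8, 9, 13]),
    ([1, 5, 4], [11, 10, 2, 6, 7, 15, 13, 9, 8, 12, 14]),
    ([1, 5, 4], [13, 12, 8, 9, 11, 10, 2, 6, 7, 15, 14]),
    ([1, 5, 4, 6, 7, 15, 13], [2, 10, 11, 9, 8, 12, 14]),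
    ([1, 5, 13], [4, 6, 2, 10, 11, 9, 8, 12, 14, 15, 7]),
    ([1, 5, 7, 6, 2, 10, 14, 15, 11, 9, 13], [4, 12, 8]),
    ([1, 5, 7, 6, 2, 10, 8, 9, 13], [4, 12, 14, 15, 11]),
    ([1, 5, 7, 6, 2, 10, 8, 9, 11, 15, 13], [4, 12, 14]),
    ([1, 5, 4, 6, 7, 15, 14], [2, 10, 11, 9, 8, 12, 13]),
    ([1, 5, 13, 12, 14], [4, 6, 2, 10, 8, 9, 11, 15, 7]),
    ([1, 5, 7, 6, 2, 10, 11, 9, 13, 15, 14], [4, 12, 8]),
    ([1, 5, 7, 6, 2, 10, 14], [4, 12, 8, 9, 13, 15, 11]),
    ([1, 5, 7, 6, 2, 10, 11, 15, 14], [4, 12, 8, 9, 13]),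
    ([4, 5, 1, 9, 13, 15, 7], [8, 12, 14, 6, 2, 10, 11]),
    ([4, 5, 1, 9, 11, 10, 2, 6, 7], [8, 12, 14, 15, 13]),
    ([4, 5, 1, 9, 11, 15, 7], [13, 12, 8, 10, 2, 6, 14]),
    ([4, 5, 1, 9, 8], [7, 6, 2, 10, 14, 12, 13, 15, 11]),
    ([4, 5, 1, 9, 8], [7, 6, 2, 10, 11, 15, 14, 12, 13]),
    ([4, 5, 1, 9, 11, 15, 7, 6, 2, 10, 8], [13, 12, 14]),
    ([4, 5, 1, 9, 11], [7, 6, 2, 10, 14, 15, 13, 12, 8]),
    ([4, 5, 1, 9, 8, 12, 14, 6, 2, 10, 11], [7, 15, 13]),
    ([4, 5, 1, 9, 8, 10, 2, 6, 7, 15, 11], [13, 12, 14]),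
    ([4, 5, 1, 9, 8, 12, 13], [7, 6, 2, 10, 11, 15, 14]),
    ([4, 5, 1, 9, 11, 10, 2, 6, 7, 15, 13], [8, 12, 14]),
    ([4, 5, 1, 9, 8, 12, 13], [11, 10, 2, 6, 7, 15, 14])]"

text \<open>
  The same for the deleted vertices with codes 0 and 15.
\<close>

definition antipodal_coverings :: "(nat list \<times> nat list) list" where
  "antipodal_coverings = [
    ([1, 3, 2], [4, 5, 13, 12, 8, 9, 11, 10, 14, 6, 7]),
    ([1, 3, 2], [4, 5, 7, 6, 14, 12, 13, 9, 11, 10, 8]),
    ([1, 3, 2], [4, 5, 7, 6, 14, 12, 13, 9, 8, 10, 11]),
    ([1, 3, 2], [4, 5, 7, 6, 14, 12, 8, 10, 11, 9, 13]),
    ([1, 3, 2], [7, 6, 4, 5, 13, 12, 14, 10, 8, 9, 11]),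
    ([1, 3, 2], [7, 6, 14, 10, 11, 9, 8, 12, 4, 5, 13]),
    ([1, 3, 2], [13, 9, 11, 10, 8, 12, 4, 5, 7, 6, 14]),
    ([1, 3, 7], [2, 6, 4, 5, 13, 12, 14, 10, 8, 9, 11]),
    ([1, 3, 7], [2, 6, 14, 10, 11, 9, 8, 12, 4, 5, 13]),
    ([1, 3, 7], [2, 6, 4, 5, 13, 12, 8, 9, 11, 10, 14]),
    ([1, 3, 2, 6, 7], [8, 10, 11, 9, 13, 5, 4, 12, 14]),
    ([1, 3, 7, 6, 14], [2, 10, 11, 9, 8, 12, 4, 5, 13])]"

lemma antipodal_coverings_ok: "list_all (\<lambda>(p, q). covering_ok (vertex 15) (map vertex p) (map vertex q)) antipodal_coverings"
  by code_simp

lemma near_coverings_ok: "list_all (\<lambda>(p, q). covering_ok (vertex 3) (map vertex p) (map vertex q)) near_coverings"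
  by code_simp

lemma antipodal_coverings_complete:
  "radix_subset 16 (map key sorted_odd_ends) (map key (orbit_ends (vertex 15) antipodal_coverings))"
  by code_simp

lemma near_coverings_complete:
  "radix_subset 16 (map key sorted_odd_ends) (map key (orbit_ends (vertex 3) near_coverings))"
  by code_simp

lemma vertex_in_cube: "vertex k \<in> cube 4"
  by (simp add: vertex_def cube_def)

lemma card_cube: "card (cube n) = 2 ^ n"
  using card_lists_length_eq[of "UNIV :: bool set" n] by (simp add: cube_def)

lemma links_ends: "links V a b c d \<Longrightarrow> {a, b, c, d} \<subseteq> V"
  unfolding links_def using spans_ends by blast

lemma covering_ok_links:
  assumes "covering_ok s p q" "s \<in> cube 4"
  shows "links (cube 4 - {vertex 0, s}) (hd p) (last p) (hd q) (last q)"
proof -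
  have pq: "p \<noteq> []" "q \<noteq> []" "successively (\<lambda>u v. hamming u v = 1) p"
    "successively (\<lambda>u v. hamming u v = 1) q" "distinct (p @ q)" "length (p @ q) = 14"
    "vertex 0 \<noteq> s" and sub: "set (p @ q) \<subseteq> cube 4 - {vertex 0, s}"
    using assms(1) by (auto simp: covering_ok_def list_all_iff cube_def)
  have "card (cube 4 - {vertex 0, s}) = 16 - 2"
    using assms(2) vertex_in_cube pq(7) by (subst card_Diff_subset) (auto simp: card_cube)
  moreover have "card (set (p @ q)) = 14"
    using distinct_card[OF pq(5)] pq(6) by simp
  ultimately have "set (p @ q) = cube 4 - {vertex 0, s}"
    using card_subset_eq[OF _ sub] finite_cube by simp
  moreover have "spans (set p) (hd p) (last p)" "spans (set q) (hd q) (last q)"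
    using pq spansI by auto
  moreover have "set p \<inter> set q = {}" using pq(5) by simp
  ultimately show ?thesis unfolding links_def by (intro exI[of _ "set p"] exI[of _ "set q"]) simp
qed

fun ends_linked where
  "ends_linked V (a, b, c, d) \<longleftrightarrow> links V a b c d"

lemma ends_linked_sort: "ends_linked V (sort_ends e) \<longleftrightarrow> ends_linked V e"
proof -
  obtain a b c d where e: "e = (a, b, c, d)" by (cases e)
  have flip: "links V a b c d \<longleftrightarrow> links V c d a b" for a b c d
    by (rule iffI; erule links_flip)
  have swap: "links V a b c d \<longleftrightarrow> links V b a c d" for a b c d
    by (rule iffI; erule links_swap)
  have swap': "links V a b c d \<longleftrightarrow> links V a b d c" for a b c d
    using flip[of a b c d] swap[of c d a b] flip[of d c a b] by blast
  have eq: "links V b a c d = links V a b c d" "links V a b d c = links V a b c d"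
    "links V b a d c = links V a b c d" "links V c d a b = links V a b c d"
    "links V c d b a = links V a b c d" "links V d c a b = links V a b c d"
    "links V d c b a = links V a b c d"
    by (rule swap swap' trans[OF swap swap'] flip trans[OF swap' flip] trans[OF swap flip]
      trans[OF swap trans[OF swap' flip]])+
  have mem: "sort_ends e \<in> {(a, b, c, d), (b, a, c, d), (a, b, d, c), (b, a, d, c),
      (c, d, a, b), (c, d, b, a), (d, c, a, b), (d, c, b, a)}"
    unfolding e by (simp add: Let_def)
  have iff: "ends_linked V e' \<longleftrightarrow> links V a b c d"
    if "e' \<in> {(a, b, c, d), (b, a, c, d), (a, b, d, c), (b, a, d, c),
      (c, d, a, b), (c, d, b, a), (d, c, a, b), (d, c, b, a)}" for e'
    using that by (elim insertE emptyE) (simp_all only: ends_linked.simps eq)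
  show ?thesis using iff[OF mem] by (simp only: e ends_linked.simps)
qed

lemma vertex_zero: "vertex 0 = replicate 4 False"
  by code_simp

lemma translate_self: "translate v v = replicate (length v) False"
  by (induction v) (auto simp: translate_def)

lemma translate_zero: "translate v (replicate (length v) False) = v"
  by (induction v) (auto simp: translate_def)

lemma permute_zero:
  assumes "set \<pi> = {..<4}" "distinct \<pi>"
  shows "permute \<pi> (vertex 0) = vertex 0"
proof -
  have "map ((!) (vertex 0)) \<pi> = map (\<lambda>_. False) \<pi>"
    using assms(1) by (intro map_cong refl) (simp add: vertex_zero)
  then have "permute \<pi> (vertex 0) = replicate (length \<pi>) False"
    by (simp add: permute_def map_replicate_const)
  moreover have "length \<pi> = 4" using distinct_card[OF assms(2)] assms(1) by simp
  ultimately show ?thesis by (simp add: vertex_zero)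
qed

lemma stabilizerD:
  assumes "\<pi> \<in> set (stabilizer s)"
  shows "isometry 4 (permute \<pi>)" "permute \<pi> s = s" "permute \<pi> (vertex 0) = vertex 0"
proof -
  have \<pi>: "distinct \<pi>" "length \<pi> = 4" "set \<pi> \<subseteq> {0, 1, 2, 3}" "permute \<pi> s = s"
    using assms by (auto simp: stabilizer_def set_n_lists)
  have "{0, 1, 2, 3} = {..<4::nat}" by auto
  then have "set \<pi> = {..<4}"
    using card_subset_eq[of "{..<4::nat}" "set \<pi>"] \<pi> distinct_card[OF \<pi>(1)] by simp
  then show "isometry 4 (permute \<pi>)" "permute \<pi> (vertex 0) = vertex 0"
    using isometry_permute permute_zero \<pi>(1) by blast+
  show "permute \<pi> s = s" by fact
qed

lemma ends_linked_isometry: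
  assumes "isometry n f" "ends_linked (cube n - {r, s}) e" "{r, s} \<subseteq> cube n"
  shows "ends_linked (cube n - {f r, f s}) (map_ends f e)"
  using assms links_isometry[OF assms(1)] by (cases e) auto

lemma orbit_ends_sound:
  assumes T: "list_all (\<lambda>(p, q). covering_ok s (map vertex p) (map vertex q)) T"
    and s: "s \<in> cube 4" and e: "e \<in> set (orbit_ends s T)"
  shows "ends_linked (cube 4 - {vertex 0, s}) e"
proof -
  define img where
    "img \<pi> p q = map_ends (permute \<pi>) (map_ends vertex (hd p, last p, hd q, last q))" for \<pi> p q
  have "\<exists>\<pi>\<in>set (stabilizer s). \<exists>(p, q)\<in>set T.
      e \<in> {sort_ends (img \<pi> p q), sort_ends (map_ends (translate s) (img \<pi> p q))}"
    using e by (force simp: orbit_ends_def Let_def img_def simp del: map_ends.simps sort_ends.simps)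
  then obtain \<pi> p q e' where pq: "(p, q) \<in> set T" and \<pi>: "\<pi> \<in> set (stabilizer s)"
    and e': "e' = map_ends (permute \<pi>) (map_ends vertex (hd p, last p, hd q, last q))"
    and ee: "e = sort_ends e' \<or> e = sort_ends (map_ends (translate s) e')"
    unfolding img_def by blast
  have V: "{vertex 0, s} \<subseteq> cube 4" using s vertex_in_cube by simp
  have ok: "covering_ok s (map vertex p) (map vertex q)"
    using T pq by (auto simp: list_all_iff)
  then have "p \<noteq> []" "q \<noteq> []" by (auto simp: covering_ok_def)
  then have "ends_linked (cube 4 - {vertex 0, s}) (map_ends vertex (hd p, last p, hd q, last q))"
    using covering_ok_links[OF ok s] by (simp add: hd_map last_map)
  from ends_linked_isometry[OF stabilizerD(1)[OF \<pi>] this V]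
  have 1: "ends_linked (cube 4 - {vertex 0, s}) e'"
    unfolding e' by (simp add: stabilizerD(2)[OF \<pi>] stabilizerD(3)[OF \<pi>])
  have "translate s (vertex 0) = s" "translate s s = vertex 0"
    using s translate_zero[of s] translate_self[of s] by (simp_all add: vertex_zero cube_def)
  then have "ends_linked (cube 4 - {vertex 0, s}) (map_ends (translate s) e')"
    using ends_linked_isometry[OF isometry_translate[OF s] 1 V] by (simp add: insert_commute)
  then show ?thesis using ee 1 by (auto simp: ends_linked_sort)
qed

lemma cube_4_cases: "v \<in> cube 4 \<Longrightarrow> \<exists>x y z w. v = [x, y, z, w]"
  by (auto simp: cube_def numeral_eq_Suc length_Suc_conv)

lemma odd_vertex_cases:
  assumes "v \<in> cube 4" "\<not> even_vertex v"
  shows "v \<in> set odd_vertices"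
proof -
  obtain x y z w where v: "v = [x, y, z, w]"
    using assms(1) cube_4_cases by blast
  then show ?thesis using assms(2)
    by (cases x; cases y; cases z; cases w) (simp_all add: odd_vertices_def vertex_def)
qed

lemma even_vertex_zero [simp]: "even_vertex (vertex 0)"
  by (simp add: vertex_def even_vertex_def)

text \<open>
  The tables settle the positions that \<open>sort_ends\<close> leaves unchanged; all others are reduced to
  these by reversing and exchanging the paths.
\<close>

lemma linkable_base_normalized:
  assumes s: "s \<in> {vertex 3, vertex 15}" and bal: "balanced 4 (vertex 0) s a b c d"
  shows "links (cube 4 - {vertex 0, s}) a b c d"
proof -
  define T where "T = (if s = vertex 3 then near_coverings else antipodal_coverings)"
  have ne: "vertex 15 \<noteq> vertex 3" by (simp add: vertex_def)
  have T: "list_all (\<lambda>(p, q). covering_ok s (map vertex p) (map vertex q)) T"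
    "radix_subset 16 (map key sorted_odd_ends) (map key (orbit_ends s T))"
    using s near_coverings_ok antipodal_coverings_ok near_coverings_complete antipodal_coverings_complete ne
    by (auto simp: T_def)
  have s4: "s \<in> cube 4" using s vertex_in_cube by auto
  let ?L = "links (cube 4 - {vertex 0, s})"
  have sorted: "?L a b c d" if bal: "balanced 4 (vertex 0) s a b c d"
    and less: "precedes a b" "precedes c d" "precedes a c" for a b c d
  proof -
    have V: "{a, b, c, d} \<subseteq> cube 4" "distinct [a, b, c, d]"
      "\<forall>g\<in>{a, b, c, d}. \<not> even_vertex g" using bal by (auto simp: balanced_def)
    then have "{a, b, c, d} \<subseteq> set odd_vertices" using odd_vertex_cases by blast
    then have "(a, b, c, d) \<in> set sorted_odd_ends"
      using V(2) less by (auto simp: sorted_odd_ends_def Let_def)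
    then have "key (a, b, c, d) \<in> set (map key sorted_odd_ends)" by force
    moreover have len: "length a = 4" "length b = 4" "length c = 4" "length d = 4"
      using V(1) by (auto simp: cube_def)
    ultimately have "key (a, b, c, d) \<in> set (map key (orbit_ends s T))"
      by (intro radix_subset_sound[OF T(2)]) simp_all
    then obtain e where e: "e \<in> set (orbit_ends s T)" "key e = key (a, b, c, d)" by auto
    obtain a' b' c' d' where e': "e = (a', b', c', d')" by (cases e)
    have "links (cube 4 - {vertex 0, s}) a' b' c' d'"
      using orbit_ends_sound[OF T(1) s4 e(1)] by (simp add: e')
    then have "length a' = 4 \<and> length b' = 4 \<and> length c' = 4 \<and> length d' = 4"
      using links_ends by (fastforce simp: cube_def)
    then have "e = (a, b, c, d)" using e(2) len by (simp add: e')
    then show ?thesis using orbit_ends_sound[OF T(1) s4 e(1)] by simp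
  qed
  have pair2: "?L a b c d" if bal: "balanced 4 (vertex 0) s a b c d"
    and less: "precedes a b" "precedes c d" for a b c d
  proof -
    have "precedes a c \<or> precedes c a"
      using bal by (intro precedes_total) (auto simp: balanced_def cube_def)
    then show ?thesis
      using sorted[OF bal less] sorted[OF balanced_sym(3)[OF bal] less(2,1)] links_flip by blast
  qed
  have pair1: "?L a b c d" if bal: "balanced 4 (vertex 0) s a b c d"
    and less: "precedes c d" for a b c d
  proof -
    have "precedes a b \<or> precedes b a"
      using bal by (intro precedes_total) (auto simp: balanced_def cube_def)
    then show ?thesis
      using pair2[OF bal _ less] pair2[OF balanced_sym(2)[OF bal] _ less] links_swap by blast
  qed
  have "precedes c d \<or> precedes d c"
    using bal by (intro precedes_total) (auto simp: balanced_def cube_def)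
  then show ?thesis
  proof
    assume "precedes c d"
    then show ?thesis by (rule pair1[OF bal])
  next
    assume *: "precedes d c"
    note b = balanced_sym(3)[OF balanced_sym(2)[OF balanced_sym(3)[OF bal]]]
    show ?thesis using links_flip[OF links_swap[OF links_flip[OF pair1[OF b *]]]] .
  qed
qed

text \<open>
  Translation moves \<open>r\<close> to zero, which turns \<open>s\<close> into a nonzero vertex of even weight; a
  permutation of the coordinates then moves the ones of that vertex to the front.
\<close>

lemma linkable_4: "linkable 4"
  unfolding linkable_def
proof (intro allI impI)
  fix r s a b c d assume bal: "balanced 4 r s a b c d"
  then have V: "{r, s, a, b, c, d} \<subseteq> cube 4" "r \<noteq> s" "even_vertex s = even_vertex r"
    by (simp_all add: balanced_def)
  define s' where "s' = translate r s"
  define \<pi> where "\<pi> = filter ((!) s') [0, 1, 2, 3] @ filter (\<lambda>i. \<not> s' ! i) [0, 1, 2, 3]"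
  define f where "f = permute \<pi> \<circ> translate r"
  have tr: "isometry 4 (translate r)" by (rule isometry_translate) (use V in simp)
  have "{0, 1, 2, 3} = {..<4::nat}" by auto
  then have \<pi>: "distinct \<pi>" "set \<pi> = {..<4}" unfolding \<pi>_def by auto
  then have p: "isometry 4 (permute \<pi>)" by (rule isometry_permute)
  have f: "isometry 4 f" unfolding f_def by (rule isometry_comp[OF p tr])
  have z: "translate r r = vertex 0"
    using V(1) translate_self[of r] by (simp add: vertex_zero cube_def)
  have "s' \<in> cube 4" using tr V(1) by (simp add: s'_def isometry_def)
  moreover have "even_vertex s'" "s' \<noteq> vertex 0"
    using isometry_same_parity[OF tr, of s r] inj_on_eq_iff[OF isometry_inj[OF tr], of s r] V z
    by (auto simp: s'_def)
  moreover obtain x y z w where "s' = [x, y, z, w]"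
    using calculation(1) cube_4_cases by blast
  ultimately have "permute \<pi> s' \<in> {vertex 3, vertex 15}" unfolding \<pi>_def
    by (cases x; cases y; cases z; cases w)
      (simp_all add: vertex_def even_vertex_def permute_def)
  then have fs: "f s \<in> {vertex 3, vertex 15}" by (simp add: f_def s'_def)
  have fr: "f r = vertex 0" using permute_zero[OF \<pi>(2,1)] z by (simp add: f_def)
  have "links (cube 4 - {f r, f s}) (f a) (f b) (f c) (f d)"
    using linkable_base_normalized[OF fs] isometry_balanced[OF f bal] by (simp add: fr)
  then show "links (cube 4 - {r, s}) a b c d" using links_isometry_iff[OF f V(1)] by simp
qed

section \<open>Coverings of faulty hypercubes\<close>

lemma linkable_ge_4: "n \<ge> 4 \<Longrightarrow> linkable n"
  by (induction n rule: dec_induct) (use linkable_4 linkable_Suc in auto)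

lemma verts_faulty: "verts (faulty_hypercube n F) = cube n - F"
  by (simp add: faulty_hypercube_def hypercube_def cube_def)

lemma arcs_ends_faulty:
  "arcs_ends (faulty_hypercube n F) =
     {(u, v). u \<in> cube n - F \<and> v \<in> cube n - F \<and> hamming u v = 1}"
proof -
  have "arcs_ends (faulty_hypercube n F) =
     {(u, v). u \<in> cube n - F \<and> v \<in> cube n - F \<and> card {i. i < n \<and> u ! i \<noteq> v ! i} = 1}"
    by (auto simp: arcs_ends_def arc_to_ends_def faulty_hypercube_def hypercube_def cube_def image_iff)
  then show ?thesis
    using hamming_conv_card by (auto simp: cube_def)
qed

lemma vwalk_arcs_subset_iff:
  "set (vwalk_arcs p) \<subseteq> {(u, v). R u v} \<longleftrightarrow> successively R p"
  by (induction p rule: vwalk_arcs.induct) auto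

lemma vpath_faulty:
  "vpath p (faulty_hypercube n F) \<longleftrightarrow> p \<noteq> [] \<and> distinct p \<and> set p \<subseteq> cube n - F \<and>
     successively (\<lambda>u v. hamming u v = 1) p"
proof -
  have "successively (\<lambda>u v. u \<in> V \<and> v \<in> V \<and> hamming u v = 1) p \<longleftrightarrow>
      successively (\<lambda>u v. hamming u v = 1) p" if "set p \<subseteq> V" for V
    using that by (intro successively_cong) auto
  then show ?thesis
    unfolding vpath_def vwalk_def arcs_ends_faulty verts_faulty vwalk_arcs_subset_iff by blast
qed

lemma vpath_spans:
  assumes p: "vpath p (faulty_hypercube n F)" and ends: "path_ends p = {a, b}"
  shows "spans (set p) a b \<and> set p \<subseteq> cube n - F"
proof -
  have "spans (set p) (hd p) (last p)" "set p \<subseteq> cube n - F"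
    using p spansI[of p] by (simp_all add: vpath_faulty)
  moreover have "hd p = a \<and> last p = b \<or> hd p = b \<and> last p = a"
    using ends by (auto simp: path_ends_def doubleton_eq_iff)
  ultimately show ?thesis using spans_sym[of "set p" b a] by auto
qed

lemma links_path_covering:
  assumes "links (cube n - F) a b c d"
  obtains p q where "path_covering (faulty_hypercube n F) {p, q}" "p \<noteq> q"
    "path_ends p = {a, b}" "path_ends q = {c, d}"
proof -
  obtain A B where AB: "A \<inter> B = {}" "A \<union> B = cube n - F" "spans A a b" "spans B c d"
    using assms by (auto simp: links_def)
  obtain p where p: "p \<noteq> []" "hd p = a" "last p = b" "distinct p"
    "successively (\<lambda>u v. hamming u v = 1) p" "set p = A" by (rule spansE[OF AB(3)])
  obtain q where q: "q \<noteq> []" "hd q = c" "last q = d" "distinct q"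
    "successively (\<lambda>u v. hamming u v = 1) q" "set q = B" by (rule spansE[OF AB(4)])
  have "path_covering (faulty_hypercube n F) {p, q}"
    unfolding path_covering_def verts_faulty using p q AB(1,2)
    by (auto simp: vpath_faulty pairwise_insert disjnt_def)
  moreover have "p \<noteq> q" using p(1,6) q(6) AB(1) by auto
  ultimately show thesis using that p q by (simp add: path_ends_def)
qed

lemma two_path_covering_joining_if_links:
  assumes "links (cube n - F) a b c d"
  shows "two_path_covering_joining n F a b c d"
proof -
  obtain p q where "path_covering (faulty_hypercube n F) {p, q}" "p \<noteq> q"
    "path_ends p = {a, b}" "path_ends q = {c, d}" by (rule links_path_covering[OF assms])
  then show ?thesis unfolding two_path_covering_joining_def k_path_covering_def
    by (intro exI[of _ p] exI[of _ q]) simp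
qed

lemma two_red_four_green_balanced:
  assumes "two_red_four_green c n [r, s] [g1, g2, g3, g4]"
  shows "balanced n r s g1 g2 g3 g4"
  using assms by (auto simp: two_red_four_green_def balanced_def hypercube_def cube_def red_def green_def)

lemma green_links:
  assumes "n \<ge> 4" "two_red_four_green c n [r, s] [g1, g2, g3, g4]"
  shows "links (cube n - {r, s}) g1 g2 g3 g4"
  using linkable_ge_4[OF assms(1)] two_red_four_green_balanced[OF assms(2)] by (simp add: linkable_def)

section \<open>Dimension three\<close>

lemma spans_step:
  assumes "spans A a b" "a \<noteq> b"
  obtains w where "w \<in> A" "hamming a w = 1"
proof -
  obtain p where p: "p \<noteq> []" "hd p = a" "last p = b" "distinct p"
    "successively (\<lambda>u v. hamming u v = 1) p" "set p = A" by (rule spansE[OF assms(1)])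
  then obtain w q where "p = a # w # q" using assms(2) by (cases p rule: remdups_adj.cases) auto
  then show thesis using that[of w] p by auto
qed

lemma cube_3_cases: "v \<in> cube 3 \<Longrightarrow> \<exists>x y z. v = [x, y, z]"
  by (auto simp: cube_def numeral_eq_Suc length_Suc_conv)

text \<open>
  In \<open>B\<close> either end has one neighbour outside \<open>F\<close>, and these two vertices are also the only
  neighbours outside \<open>F\<close> of the first end of \<open>A\<close>.
\<close>

lemma no_linkage_in_Q3:
  assumes A: "spans A [\<not> x, True, True] [\<not> x, False, False]" "A \<subseteq> cube 3 - F"
    and B: "spans B [x, True, False] [x, False, True]" "B \<subseteq> cube 3 - F"
    and F: "F = {[x, False, False], [x, True, True]}"
  shows "A \<inter> B \<noteq> {}"
proof -
  have nbr: "w \<in> {[\<not> a, b, c], [a, \<not> b, c], [a, b, \<not> c]}"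
    if w3: "w \<in> cube 3" and dist: "hamming [a, b, c] w = 1" for a b c w
  proof -
    obtain a' b' c' where w: "w = [a', b', c']"
      using cube_3_cases[OF w3] by blast
    show ?thesis using dist unfolding w
      by (cases "a = a'"; cases "b = b'"; cases "c = c'") simp_all
  qed
  obtain u where u: "u \<in> A" "hamming [\<not> x, True, True] u = 1" by (rule spans_step[OF A(1)]) simp_all
  obtain v where v: "v \<in> B" "hamming [x, True, False] v = 1" by (rule spans_step[OF B(1)]) simp_all
  obtain w where w: "w \<in> B" "hamming [x, False, True] w = 1"
    by (rule spans_step[OF spans_sym[OF B(1)]]) simp_all
  have "u \<in> cube 3" "u \<notin> F" using u(1) A(2) by auto
  then have "u = [\<not> x, True, False] \<or> u = [\<not> x, False, True]"
    using nbr[OF _ u(2)] F by auto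
  moreover have "v \<in> cube 3" "v \<notin> F" using v(1) B(2) by auto
  then have "v = [\<not> x, True, False]" using nbr[OF _ v(2)] F by auto
  moreover have "w \<in> cube 3" "w \<notin> F" using w(1) B(2) by auto
  then have "w = [\<not> x, False, True]" using nbr[OF _ w(2)] F by auto
  ultimately show ?thesis using u(1) v(1) w(1) by auto
qed

text \<open>
  The first coordinate depends on \<open>c\<close> so that the deleted vertices are red for either
  convention.  The first two ends are the antipodes of the deleted vertices.
\<close>

lemma bad_configuration:
  "two_red_four_green c 3 [[\<not> c, False, False], [\<not> c, True, True]]
     [[c, True, True], [c, False, False], [\<not> c, True, False], [\<not> c, False, True]]"
  by (cases c) (auto simp: two_red_four_green_def hypercube_def red_def green_def even_vertex_def)

lemma bad_configuration_no_paths: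
  assumes "p \<in> P" "q \<in> P" "p \<noteq> q"
    and "path_ends p = {[c, True, True], [c, False, False]}"
    and "path_ends q = {[\<not> c, True, False], [\<not> c, False, True]}"
  shows "\<not> path_covering (faulty_hypercube 3 {[\<not> c, False, False], [\<not> c, True, True]}) P"
proof
  let ?F = "{[\<not> c, False, False], [\<not> c, True, True]}"
  assume cov: "path_covering (faulty_hypercube 3 ?F) P"
  then have "vpath p (faulty_hypercube 3 ?F)" "vpath q (faulty_hypercube 3 ?F)"
    using assms by (auto simp: path_covering_def)
  note pq = vpath_spans[OF this(1) assms(4)] vpath_spans[OF this(2) assms(5)]
  have "set p \<inter> set q = {}"
    using cov assms(1-3) by (auto simp: path_covering_def pairwise_def disjnt_def)
  then show False using no_linkage_in_Q3[of "set p" "\<not> c" ?F "set q"] pq by simp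
qed

section \<open>Freely prescribable ends\<close>

text \<open>
  The balance condition is invariant under exchanging the colours, since both sides change
  their sign.  So a fault with two green vertices is one with two red vertices for the other
  convention.
\<close>

lemma in_balance_Not: "in_balance (\<not> c) n F E \<longleftrightarrow> in_balance c n F E"
proof -
  have "red (\<not> c) v \<longleftrightarrow> green c v" "green (\<not> c) v \<longleftrightarrow> red c v" for v
    by (auto simp: red_def green_def)
  then show ?thesis by (auto simp: in_balance_def signed_charge_def red_pair_def green_pair_def)
qed

lemma freely_prescribe_ends_Not:
  "freely_prescribe_ends (\<not> c) n F N K \<longleftrightarrow> freely_prescribe_ends c n F N K"
  by (simp add: freely_prescribe_ends_def prescribable_ends_def in_balance_Not)

lemma green_pairs_prescribable:
  assumes "two_red_four_green c n [r, s] [g1, g2, g3, g4]"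
  shows "prescribable_ends c n {r, s} 0 2 {{g1, g2}, {g3, g4}}"
proof -
  let ?E = "{{g1, g2}, {g3, g4}}"
  have V: "{r, s, g1, g2, g3, g4} \<subseteq> cube n" "r \<noteq> s" "distinct [g1, g2, g3, g4]"
    "red c r" "red c s" "\<And>g. g \<in> {g1, g2, g3, g4} \<Longrightarrow> green c g"
    using assms by (auto simp: two_red_four_green_def hypercube_def cube_def)
  have par: "even_vertex g \<longleftrightarrow> \<not> c" if "g \<in> {g1, g2, g3, g4}" for g
    using V(6)[OF that] by (auto simp: red_def green_def)
  have ne: "{g1, g2} \<noteq> {g3, g4}" using V(3) by (auto simp: doubleton_eq_iff)
  have green: "green_pair c e" "charged_pair e" "\<not> neutral_pair e" "\<not> red_pair c e"
    if mem: "e \<in> ?E" for e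
  proof -
    obtain u v where e: "e = {u, v}" "u \<noteq> v" "{u, v} \<subseteq> {g1, g2, g3, g4}" using mem V(3) by auto
    then have "even_vertex w \<longleftrightarrow> \<not> c" if "w \<in> e" for w using par that by auto
    moreover show "charged_pair e" unfolding charged_pair_def using e(1,2) calculation by blast
    ultimately show "green_pair c e" "\<not> neutral_pair e" "\<not> red_pair c e"
      using e(1) by (auto simp: green_pair_def red_pair_def neutral_pair_def green_def red_def doubleton_eq_iff)
  qed
  have "{v \<in> {r, s}. red c v} = {r, s}" "{v \<in> {r, s}. green c v} = {}"
    using V(4,5) by (auto simp: green_def)
  then have "signed_charge c {r, s} = 2" using V(2) by (simp add: signed_charge_def)
  moreover have "{e \<in> ?E. green_pair c e} = ?E" "{e \<in> ?E. red_pair c e} = {}"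
    "{e \<in> ?E. neutral_pair e} = {}" "{e \<in> ?E. charged_pair e} = ?E" using green by blast+
  moreover have "card ?E = 2" using ne by simp
  moreover have "\<Union> ?E \<subseteq> verts (faulty_hypercube n {r, s})"
    using V(1,4,5,6) by (auto simp: verts_faulty green_def)
  moreover have "disjoint_pairs ?E"
    using V(3) by (auto simp: disjoint_pairs_def pairwise_insert disjnt_def)
  ultimately show ?thesis by (simp add: prescribable_ends_def in_balance_def)
qed

text \<open>
  A pair is neutral or charged, so there are exactly two pairs, both charged.  The charge of the
  fault being 2, both of them must be green.
\<close>

lemma prescribable_green_pairs:
  assumes F: "fault n {r, s}" "r \<noteq> s" "red c r" "red c s"
    and E: "prescribable_ends c n {r, s} 0 2 E"
  obtains g1 g2 g3 g4 where "E = {{g1, g2}, {g3, g4}}"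
    "two_red_four_green c n [r, s] [g1, g2, g3, g4]"
proof -
  have E': "disjoint_pairs E" "\<Union> E \<subseteq> cube n - {r, s}" "card {e \<in> E. neutral_pair e} = 0"
    "card {e \<in> E. charged_pair e} = 2"
    "signed_charge c {r, s} = int (card {e \<in> E. green_pair c e}) - int (card {e \<in> E. red_pair c e})"
    using E by (auto simp: prescribable_ends_def in_balance_def verts_faulty)
  have "E \<subseteq> Pow (cube n)" using E'(2) by blast
  then have fin: "finite E" using finite_cube finite_subset by blast
  have "neutral_pair e \<or> charged_pair e" if "e \<in> E" for e
  proof -
    have "card e = 2" using that E'(1) by (simp add: disjoint_pairs_def)
    then obtain u v where "e = {u, v}" "u \<noteq> v" by (auto simp: card_2_iff)
    then show ?thesis unfolding neutral_pair_def charged_pair_def by blast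
  qed
  moreover have "{e \<in> E. neutral_pair e} = {}" using E'(3) fin by simp
  ultimately have "{e \<in> E. charged_pair e} = E" by blast
  then have cardE: "card E = 2" using E'(4) by simp
  have "{v \<in> {r, s}. red c v} = {r, s}" "{v \<in> {r, s}. green c v} = {}"
    using F(3,4) by (auto simp: green_def)
  then have "signed_charge c {r, s} = 2" using F(2) by (simp add: signed_charge_def)
  then have "card {e \<in> E. green_pair c e} \<ge> card E" using E'(5) cardE by linarith
  then have "{e \<in> E. green_pair c e} = E" using fin by (intro card_seteq) auto
  then have green: "\<forall>v\<in>e. green c v" if "e \<in> E" for e
    using that by (auto simp: green_pair_def)
  obtain e e' where e: "E = {e, e'}" "e \<noteq> e'" using cardE by (auto simp: card_2_iff)
  moreover obtain g1 g2 where g12: "e = {g1, g2}" "g1 \<noteq> g2"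
    using E'(1) e(1) by (auto simp: disjoint_pairs_def card_2_iff)
  moreover obtain g3 g4 where g34: "e' = {g3, g4}" "g3 \<noteq> g4"
    using E'(1) e(1) by (auto simp: disjoint_pairs_def card_2_iff)
  moreover have "e \<inter> e' = {}" using E'(1) e by (auto simp: disjoint_pairs_def pairwise_def disjnt_def)
  ultimately have "two_red_four_green c n [r, s] [g1, g2, g3, g4]"
    using F E'(2) green[of e] green[of e'] unfolding two_red_four_green_def
    by (auto simp: fault_def hypercube_def cube_def)
  then show thesis using that e(1) g12(1) g34(1) by blast
qed

lemma freely_prescribe_ends_red:
  assumes n: "n \<ge> 4" and F: "fault n {r, s}" "r \<noteq> s" "red c r" "red c s"
  shows "freely_prescribe_ends c n {r, s} 0 2"
  unfolding freely_prescribe_ends_def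
proof (intro conjI allI impI)
  have r: "r \<in> cube n" and len: "length [] < n" "length [x] < n" "length [x, y] < n" "length [x, y, z] < n"
    for x y z :: "bool list"
    using F(1) n by (simp_all add: fault_def hypercube_def cube_def)
  obtain g1 where g1: "g1 \<in> cube n" "hamming r g1 = 1" "g1 \<notin> set []" "even_vertex g1 \<longleftrightarrow> \<not> even_vertex r"
    by (rule neighbour_avoiding[OF r len(1)])
  obtain g2 where g2: "g2 \<in> cube n" "hamming r g2 = 1" "g2 \<notin> set [g1]" "even_vertex g2 \<longleftrightarrow> \<not> even_vertex r"
    by (rule neighbour_avoiding[OF r len(2)])
  obtain g3 where g3: "g3 \<in> cube n" "hamming r g3 = 1" "g3 \<notin> set [g1, g2]" "even_vertex g3 \<longleftrightarrow> \<not> even_vertex r"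
    by (rule neighbour_avoiding[OF r len(3)])
  obtain g4 where g4: "g4 \<in> cube n" "hamming r g4 = 1" "g4 \<notin> set [g1, g2, g3]" "even_vertex g4 \<longleftrightarrow> \<not> even_vertex r"
    by (rule neighbour_avoiding[OF r len(4)])
  have "two_red_four_green c n [r, s] [g1, g2, g3, g4]"
    using F g1 g2 g3 g4
    by (auto simp: two_red_four_green_def fault_def hypercube_def cube_def red_def green_def)
  from green_pairs_prescribable[OF this]
  show "\<exists>E. prescribable_ends c n {r, s} 0 2 E" by blast
next
  fix E assume "prescribable_ends c n {r, s} 0 2 E"
  from prescribable_green_pairs[OF F this] obtain g1 g2 g3 g4
    where E: "E = {{g1, g2}, {g3, g4}}" "two_red_four_green c n [r, s] [g1, g2, g3, g4]" .
  obtain p q where "path_covering (faulty_hypercube n {r, s}) {p, q}"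
    "path_ends p = {g1, g2}" "path_ends q = {g3, g4}"
    by (rule links_path_covering[OF green_links[OF n E(2)]])
  then show "\<exists>P. path_covering (faulty_hypercube n {r, s}) P \<and> path_ends ` P = E"
    using E(1) by (intro exI[of _ "{p, q}"]) simp
qed

lemma fault_charge_two:
  assumes "mass F = 2" "charge c F = 2"
  obtains r s where "F = {r, s}" "r \<noteq> s" "red c r \<and> red c s \<or> red (\<not> c) r \<and> red (\<not> c) s"
proof -
  obtain r s where rs: "F = {r, s}" "r \<noteq> s" using assms(1) by (auto simp: mass_def card_2_iff)
  have "{v \<in> {r, s}. P v} = (if P r then {r} else {}) \<union> (if P s then {s} else {})" for P by auto
  then have "red c r \<longleftrightarrow> red c s"
    using assms(2) rs(2) by (cases "red c r"; cases "red c s")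
      (auto simp: rs(1) charge_def signed_charge_def green_def)
  then show thesis using that[OF rs] by (auto simp: red_def)
qed

lemma four_admissible: "4 \<in> admissible_dims c 2 2 0 2"
proof -
  have "freely_prescribe_ends c n F 0 2"
    if n: "n \<ge> 4" and F: "fault n F" "mass F = 2" "charge c F = 2" for n F
  proof -
    obtain r s where rs: "F = {r, s}" "r \<noteq> s" "red c r \<and> red c s \<or> red (\<not> c) r \<and> red (\<not> c) s"
      by (rule fault_charge_two[OF F(2,3)])
    have "freely_prescribe_ends c' n {r, s} 0 2" if "red c' r \<and> red c' s" for c'
      using freely_prescribe_ends_red[OF n _ rs(2)] F(1) rs(1) that by simp
    then show ?thesis using rs(1,3) freely_prescribe_ends_Not by blast
  qed
  moreover have "log 2 8 \<le> log 2 (2 ^ 4 :: real)" by simp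
  then have "log 2 8 \<le> (4 :: real)" by (subst (asm) log_pow_cancel) simp_all
  ultimately show ?thesis by (simp add: admissible_dims_def)
qed

text \<open>
  An admissible dimension below four would make the position without a covering in the 3-cube
  freely prescribable.
\<close>

lemma three_not_admissible:
  assumes "m \<le> 3"
  shows "m \<notin> admissible_dims c 2 2 0 2"
proof
  assume m: "m \<in> admissible_dims c 2 2 0 2"
  define r s where rs: "r = [\<not> c, False, False]" "s = [\<not> c, True, True]"
  define g1 g2 g3 g4 where g: "g1 = [c, True, True]" "g2 = [c, False, False]"
    "g3 = [\<not> c, True, False]" "g4 = [\<not> c, False, True]"
  have bad: "two_red_four_green c 3 [r, s] [g1, g2, g3, g4]"
    using bad_configuration by (simp add: rs g)
  then have "r \<noteq> s" "red c r" "red c s" "fault 3 {r, s}"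
    by (auto simp: two_red_four_green_def fault_def)
  then have "fault 3 {r, s}" "mass {r, s} = 2" "charge c {r, s} = 2"
    by (auto simp: mass_def charge_def signed_charge_def green_def conj_disj_distribR Collect_disj_eq
        cong: conj_cong)
  then have "freely_prescribe_ends c 3 {r, s} 0 2"
    using m assms by (auto simp: admissible_dims_def)
  then obtain P where P: "path_covering (faulty_hypercube 3 {r, s}) P"
    "path_ends ` P = {{g1, g2}, {g3, g4}}"
    using green_pairs_prescribable[OF bad] by (auto simp: freely_prescribe_ends_def)
  have ends: "{g1, g2} \<in> path_ends ` P" "{g3, g4} \<in> path_ends ` P" unfolding P(2) by simp_all
  from ends(1) obtain p where p: "{g1, g2} = path_ends p" "p \<in> P" by (rule imageE)
  from ends(2) obtain q where q: "{g3, g4} = path_ends q" "q \<in> P" by (rule imageE)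
   have "{g1, g2} \<noteq> {g3, g4}" by (auto simp: g doubleton_eq_iff)
  then have "p \<noteq> q" using p(1) q(1) by auto
  then show False
    using bad_configuration_no_paths[OF p(2) q(2) _ p(1)[symmetric, unfolded g] q(1)[symmetric, unfolded g]] P(1)
    by (simp add: rs)
qed

theorem lemma4p3:
  fixes c :: bool
  shows "admissible_dims c 2 2 0 2 \<noteq> {} \<and> least_dim c 2 2 0 2 = 4 \<and>
    (\<forall>n r1 r2 g1 g2 g3 g4. n \<ge> 4 \<and> two_red_four_green c n [r1, r2] [g1, g2, g3, g4] \<longrightarrow>
       two_path_covering_joining n {r1, r2} g1 g2 g3 g4) \<and>
    (\<exists>r1 r2 g1 g2 g3 g4. two_red_four_green c 3 [r1, r2] [g1, g2, g3, g4] \<and>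
       \<not> two_path_covering_joining 3 {r1, r2} g1 g2 g3 g4)"
proof (intro conjI)
  show "admissible_dims c 2 2 0 2 \<noteq> {}" using four_admissible by blast
  show "least_dim c 2 2 0 2 = 4" unfolding least_dim_def
  proof (rule Least_equality)
    show "4 \<in> admissible_dims c 2 2 0 2" by (rule four_admissible)
    fix m assume "m \<in> admissible_dims c 2 2 0 2"
    then show "4 \<le> m" using three_not_admissible[of m c] by linarith
  qed
  show "\<forall>n r1 r2 g1 g2 g3 g4. n \<ge> 4 \<and> two_red_four_green c n [r1, r2] [g1, g2, g3, g4] \<longrightarrow>
       two_path_covering_joining n {r1, r2} g1 g2 g3 g4"
    using green_links two_path_covering_joining_if_links by blast
  have "\<not> two_path_covering_joining 3 {[\<not> c, False, False], [\<not> c, True, True]}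
     [c, True, True] [c, False, False] [\<not> c, True, False] [\<not> c, False, True]"
  proof
    assume "two_path_covering_joining 3 {[\<not> c, False, False], [\<not> c, True, True]}
     [c, True, True] [c, False, False] [\<not> c, True, False] [\<not> c, False, True]"
    then obtain p q where
      "path_covering (faulty_hypercube 3 {[\<not> c, False, False], [\<not> c, True, True]}) {p, q}"
      "card {p, q} = 2" "path_ends p = {[c, True, True], [c, False, False]}"
      "path_ends q = {[\<not> c, True, False], [\<not> c, False, True]}"
      by (auto simp: two_path_covering_joining_def k_path_covering_def)
    then show False using bad_configuration_no_paths[of p "{p, q}" q c] by auto
  qed
  then show "\<exists>r1 r2 g1 g2 g3 g4. two_red_four_green c 3 [r1, r2] [g1, g2, g3, g4] \<and>
       \<not> two_path_covering_joining 3 {r1, r2} g1 g2 g3 g4"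
    using bad_configuration by blast
qed

end
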